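(* Let $\mathcal{C}:\mathbf{FI}\to\mathbf{PF}$ be the pre-component functor corresponding to model functors $S\mapsto\mathcal{F}_b(S)/\!\!\sim_{b,S}$, $b\in[a]$, and compatible quasi-orders $\preceq_S$ on the disjoint unions $\mathcal{F}(S)=\bigsqcup_{b=1}^a\mathcal{F}_b(S)$. Then the number of $\mathrm{Sym}(S)$-orbits on $\mathcal{C}(S)$ is a quasipolynomial in $|S|$ for all finite sets $S$ with $|S|\gg 0$.
   Context: $[n]=\{1,\dots,n\}$. $\mathbf{FI}$ is the category of finite sets with injections. $\mathbf{PF}$ is the category of finite sets with partially defined maps. All functors $\mathbf{FI}\to\mathbf{PF}$ considered are contravariant. Model functor. Fix a finite set $S_0$, a $k\in\mathbb{Z}_{\ge 0}$, and for each finite set $S$ a subset $\mathcal{E}(S)\subseteq[k]^S$ such that for each injection $\pi:S\to T$ and $\alpha\in\mathcal{E}(T)$ we have $\alpha\circ\pi\in\mathcal{E}(S)$. Define $\mathcal{F}:\mathbf{FI}\to\mathbf{PF}$ by $$\mathcal{F}(S)=\{(\sigma,\alpha)\mid \sigma:S_0\to S\text{ injective},\ \alpha\in\mathcal{E}(S\setminus\mathrm{im}(\sigma))\}$$ and, for an injection $\pi:S\to T$ and $(\sigma,\alpha)\in\mathcal{F}(T)$, let $\mathcal{F}(\pi)((\sigma,\alpha))$ be undefined if $\mathrm{im}(\sigma)\not\subseteq\mathrm{im}(\pi)$, and otherwise $(\sigma',\alpha\circ\pi|_{S\setminus\mathrm{im}(\sigma')})$ where $\sigma':=\pi^{-1}\circ\sigma$.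 Let $\sim_S$ be an equivalence relation on $\mathcal{F}(S)$ for each $S$, such that: Axiom (1): if $(\sigma,\alpha)\sim_T(\sigma',\alpha')$ and the injection $\pi:S\to T$ has $\mathrm{im}(\pi)\supseteq\mathrm{im}(\sigma)\cup\mathrm{im}(\sigma')$, then $\mathcal{F}(\pi)((\sigma,\alpha))\sim_S\mathcal{F}(\pi)((\sigma',\alpha'))$. Axiom (2): if $(\sigma,\alpha)\in\mathcal{F}(T)$, $(\sigma'',\alpha'')\in\mathcal{F}(S)$ and the injection $\pi:S\to T$ satisfy $\mathrm{im}(\pi)\supseteq\mathrm{im}(\sigma)$ and $\mathcal{F}(\pi)((\sigma,\alpha))\sim_S(\sigma'',\alpha'')$, then there exists $(\sigma',\alpha')\in\mathcal{F}(T)$ with $\mathrm{im}(\sigma')\subseteq\mathrm{im}(\pi)$, $(\sigma',\alpha')\sim_T(\sigma,\alpha)$ and $\mathcal{F}(\pi)((\sigma',\alpha'))=(\sigma'',\alpha'')$. Axiom (3): if $(\sigma,\alpha)\sim_T(\sigma',\alpha')$ and $i,j\in T\setminus(\mathrm{im}(\sigma)\cup\mathrm{im}(\sigma'))$, then $\alpha(i)=\alpha(j)\Leftrightarrow\alpha'(i)=\alpha'(j)$. The functor $S\mapsto\mathcal{F}(S)/\!\!\sim_S$ is called a model functor. Compatible quasi-orders. Let $a\in\mathbb{Z}_{\ge 0}$ and for each $b\in[a]$ let $S\mapsto\mathcal{F}_b(S)/\!\!\sim_{b,S}$ be a model functor, constructed from a finite set $S_{0,b}$, a $k_b\in\mathbb{Z}_{\ge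 0}$ and $\mathcal{E}_b(S)\subseteq[k_b]^S$. For each finite set $S$ let $\preceq_S$ be a quasi-order (reflexive and transitive relation) on $\mathcal{F}(S):=\bigsqcup_{b=1}^a\mathcal{F}_b(S)$. The collection is called compatible if: Compatibility (1): whenever $\mathcal{F}_b(S)\ni(\sigma,\alpha)\preceq_S(\sigma',\alpha')\in\mathcal{F}_{b'}(S)$, we have $b\le b'$; Compatibility (2): the restriction of $\preceq_S$ to each $\mathcal{F}_b(S)$ equals $\sim_{b,S}$; Compatibility (3): for all injections $\pi:S\to T$ and $(\sigma,\alpha)\in\mathcal{F}_b(T)$, $(\sigma',\alpha')\in\mathcal{F}_{b'}(T)$ with $\mathrm{im}(\pi)\supseteq\mathrm{im}(\sigma)\cup\mathrm{im}(\sigma')$, if $(\sigma,\alpha)\preceq_T(\sigma',\alpha')$ then $\mathcal{F}_b(\pi)((\sigma,\alpha))\preceq_S\mathcal{F}_{b'}(\pi)((\sigma',\alpha'))$. Pre-component functor. Let $\sim_S$ be the equivalence relation on $\mathcal{F}(S)$ given by $x\sim_S y$ iff $x\preceq_S y$ and $y\preceq_S x$; then $\preceq_S$ induces a partial order on $\mathcal{F}(S)/\!\!\sim_S=\bigsqcup_b(\mathcal{F}_b(S)/\!\!\sim_{b,S})$. The pre-component functor $\mathcal{C}$ is defined on objects by $\mathcal{C}(S):=\{\text{maximal elements of }\mathcal{F}(S)/\!\!\sim_S\}$, and for an injection $\pi:S\to T$ and $c\in\mathcal{C}(T)$: if $c$ contains some $(\sigma,\alpha)\in\mathcal{F}_b(T)$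 with $\mathrm{im}(\sigma)\subseteq\mathrm{im}(\pi)$ and the class $c'$ of $\mathcal{F}_b(\pi)((\sigma,\alpha))$ is maximal in $\mathcal{F}(S)/\!\!\sim_S$, then $\mathcal{C}(\pi)(c):=c'$ (independent of choices); otherwise $\mathcal{C}(\pi)$ is undefined at $c$. The group $\mathrm{Sym}(S)$ acts on $\mathcal{C}(S)$ via the bijections $\mathcal{C}(\pi)$, $\pi\in\mathrm{Sym}(S)$. A quasipolynomial is a function $f:\mathbb{Z}\to\mathbb{R}$ of the form $f(n)=c_d(n)n^d+\cdots+c_0(n)$ where each $c_i:\mathbb{Z}\to\mathbb{R}$ is periodic with integral period. *)

theory Defs
  imports "HOL-Algebra.Group_Action" Complex_Main
begin

text \<open>
  The objects of FI are the finite subsets of an infinite type \<open>'u\<close>: every finite set is in bijection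
  with such a subset, so they form a full subcategory equivalent to FI, closed under subsets.
  All functions are extensional (they take the value \<open>undefined\<close> outside of their domain), so that
  equality in HOL is equality of functions between sets.
\<close>

definition injections :: "'a set \<Rightarrow> 'b set \<Rightarrow> ('a \<Rightarrow> 'b) set" where
  "injections S T = {\<pi> \<in> S \<rightarrow>\<^sub>E T. inj_on \<pi> S}"

type_synonym ('s, 'u) elt = "('s \<Rightarrow> 'u) \<times> ('u \<Rightarrow> nat)"

definition model_obj :: "'s set \<Rightarrow> ('u set \<Rightarrow> ('u \<Rightarrow> nat) set) \<Rightarrow> 'u set \<Rightarrow> ('s, 'u) elt set" where
  "model_obj S0 E S = {(\<sigma>, \<alpha>). \<sigma> \<in> injections S0 S \<and> \<alpha> \<in> E (S - \<sigma> ` S0)}"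

text \<open>
  For an injection \<open>\<pi>\<close> from \<open>S\<close> to \<open>T\<close>, \<open>model_map S0 S \<pi>\<close> is the partial map from
  \<open>model_obj S0 E T\<close> to \<open>model_obj S0 E S\<close>; \<open>None\<close> means undefined.
\<close>

definition model_map :: "'s set \<Rightarrow> 'u set \<Rightarrow> ('u \<Rightarrow> 'u) \<Rightarrow> ('s, 'u) elt \<Rightarrow> ('s, 'u) elt option" where
  "model_map S0 S \<pi> = (\<lambda>(\<sigma>, \<alpha>).
     if \<sigma> ` S0 \<subseteq> \<pi> ` S
     then let \<sigma>' = compose S0 (inv_into S \<pi>) \<sigma> in Some (\<sigma>', compose (S - \<sigma>' ` S0) \<alpha> \<pi>)
     else None)"

locale model_functor =
  fixes S0 :: "'s set" and k :: nat and E :: "'u set \<Rightarrow> ('u \<Rightarrow> nat) set"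
    and sim :: "'u set \<Rightarrow> ('s, 'u) elt rel"
  assumes finite_S0: "finite S0"
    and E_subset: "finite S \<Longrightarrow> E S \<subseteq> S \<rightarrow>\<^sub>E {1..k}"
    and E_compose: "\<lbrakk>finite S; finite T; \<pi> \<in> injections S T; \<alpha> \<in> E T\<rbrakk> \<Longrightarrow> compose S \<alpha> \<pi> \<in> E S"
    and equiv_sim: "finite S \<Longrightarrow> equiv (model_obj S0 E S) (sim S)"
    and axiom1: "\<lbrakk>finite S; finite T; \<pi> \<in> injections S T; ((\<sigma>, \<alpha>), (\<sigma>', \<alpha>')) \<in> sim T;
        \<sigma> ` S0 \<union> \<sigma>' ` S0 \<subseteq> \<pi> ` S\<rbrakk>
      \<Longrightarrow> (the (model_map S0 S \<pi> (\<sigma>, \<alpha>)), the (model_map S0 S \<pi> (\<sigma>', \<alpha>'))) \<in> sim S"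
    and axiom2: "\<lbrakk>finite S; finite T; \<pi> \<in> injections S T; (\<sigma>, \<alpha>) \<in> model_obj S0 E T;
        (\<sigma>'', \<alpha>'') \<in> model_obj S0 E S; \<sigma> ` S0 \<subseteq> \<pi> ` S;
        (the (model_map S0 S \<pi> (\<sigma>, \<alpha>)), (\<sigma>'', \<alpha>'')) \<in> sim S\<rbrakk>
      \<Longrightarrow> \<exists>\<sigma>' \<alpha>'. (\<sigma>', \<alpha>') \<in> model_obj S0 E T \<and> \<sigma>' ` S0 \<subseteq> \<pi> ` S \<and>
            ((\<sigma>', \<alpha>'), (\<sigma>, \<alpha>)) \<in> sim T \<and> model_map S0 S \<pi> (\<sigma>', \<alpha>') = Some (\<sigma>'', \<alpha>'')"
    and axiom3: "\<lbrakk>finite T; ((\<sigma>, \<alpha>), (\<sigma>', \<alpha>')) \<in> sim T;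
        i \<in> T - (\<sigma> ` S0 \<union> \<sigma>' ` S0); j \<in> T - (\<sigma> ` S0 \<union> \<sigma>' ` S0)\<rbrakk>
      \<Longrightarrow> \<alpha> i = \<alpha> j \<longleftrightarrow> \<alpha>' i = \<alpha>' j"

definition total_obj ::
  "nat \<Rightarrow> (nat \<Rightarrow> 's set) \<Rightarrow> (nat \<Rightarrow> 'u set \<Rightarrow> ('u \<Rightarrow> nat) set) \<Rightarrow> 'u set \<Rightarrow> (nat \<times> ('s, 'u) elt) set" where
  "total_obj a S0 E S = (SIGMA b:{1..a}. model_obj (S0 b) (E b) S)"

locale compatible_quasi_orders =
  fixes a :: nat and S0 :: "nat \<Rightarrow> 's set" and k :: "nat \<Rightarrow> nat"
    and E :: "nat \<Rightarrow> 'u set \<Rightarrow> ('u \<Rightarrow> nat) set"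
    and sim :: "nat \<Rightarrow> 'u set \<Rightarrow> ('s, 'u) elt rel"
    and qo :: "'u set \<Rightarrow> (nat \<times> ('s, 'u) elt) rel"
  assumes model: "b \<in> {1..a} \<Longrightarrow> model_functor (S0 b) (k b) (E b) (sim b)"
    and quasi_order: "finite S \<Longrightarrow> preorder_on (total_obj a S0 E S) (qo S)"
    and compat1: "\<lbrakk>finite S; ((b, x), (b', x')) \<in> qo S\<rbrakk> \<Longrightarrow> b \<le> b'"
    and compat2: "\<lbrakk>finite S; b \<in> {1..a}\<rbrakk> \<Longrightarrow> {(x, y). ((b, x), (b, y)) \<in> qo S} = sim b S"
    and compat3: "\<lbrakk>finite S; finite T; \<pi> \<in> injections S T; ((b, \<sigma>, \<alpha>), (b', \<sigma>', \<alpha>')) \<in> qo T;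
        \<sigma> ` S0 b \<union> \<sigma>' ` S0 b' \<subseteq> \<pi> ` S\<rbrakk>
      \<Longrightarrow> ((b, the (model_map (S0 b) S \<pi> (\<sigma>, \<alpha>))),
           (b', the (model_map (S0 b') S \<pi> (\<sigma>', \<alpha>')))) \<in> qo S"

definition total_sim :: "('u set \<Rightarrow> (nat \<times> ('s, 'u) elt) rel) \<Rightarrow> 'u set \<Rightarrow> (nat \<times> ('s, 'u) elt) rel" where
  "total_sim qo S = {(x, y). (x, y) \<in> qo S \<and> (y, x) \<in> qo S}"

definition total_classes ::
  "nat \<Rightarrow> (nat \<Rightarrow> 's set) \<Rightarrow> (nat \<Rightarrow> 'u set \<Rightarrow> ('u \<Rightarrow> nat) set) \<Rightarrow>
   ('u set \<Rightarrow> (nat \<times> ('s, 'u) elt) rel) \<Rightarrow> 'u set \<Rightarrow> (nat \<times> ('s, 'u) elt) set set" where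
  "total_classes a S0 E qo S = total_obj a S0 E S // total_sim qo S"

definition class_le ::
  "('u set \<Rightarrow> (nat \<times> ('s, 'u) elt) rel) \<Rightarrow> 'u set \<Rightarrow>
   (nat \<times> ('s, 'u) elt) set \<Rightarrow> (nat \<times> ('s, 'u) elt) set \<Rightarrow> bool" where
  "class_le qo S c d \<longleftrightarrow> (\<exists>x\<in>c. \<exists>y\<in>d. (x, y) \<in> qo S)"

definition comp_obj ::
  "nat \<Rightarrow> (nat \<Rightarrow> 's set) \<Rightarrow> (nat \<Rightarrow> 'u set \<Rightarrow> ('u \<Rightarrow> nat) set) \<Rightarrow>
   ('u set \<Rightarrow> (nat \<times> ('s, 'u) elt) rel) \<Rightarrow> 'u set \<Rightarrow> (nat \<times> ('s, 'u) elt) set set" where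
  "comp_obj a S0 E qo S =
     {c \<in> total_classes a S0 E qo S. \<forall>d \<in> total_classes a S0 E qo S. class_le qo S c d \<longrightarrow> d = c}"

text \<open>
  \<open>comp_image a S0 E qo S \<pi> c c'\<close>: some representative of \<open>c\<close> shows that \<open>c'\<close> is the image of \<open>c\<close>
  under the partial map from \<open>comp_obj a S0 E qo T\<close> to \<open>comp_obj a S0 E qo S\<close> associated with an
  injection \<open>\<pi>\<close> from \<open>S\<close> to \<open>T\<close>.  By \<open>compat3\<close> there is at most one such \<open>c'\<close>.
\<close>

definition comp_image ::
  "nat \<Rightarrow> (nat \<Rightarrow> 's set) \<Rightarrow> (nat \<Rightarrow> 'u set \<Rightarrow> ('u \<Rightarrow> nat) set) \<Rightarrow>
   ('u set \<Rightarrow> (nat \<times> ('s, 'u) elt) rel) \<Rightarrow> 'u set \<Rightarrow> ('u \<Rightarrow> 'u) \<Rightarrow>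
   (nat \<times> ('s, 'u) elt) set \<Rightarrow> (nat \<times> ('s, 'u) elt) set \<Rightarrow> bool" where
  "comp_image a S0 E qo S \<pi> c c' \<longleftrightarrow>
     (\<exists>b \<sigma> \<alpha>. (b, \<sigma>, \<alpha>) \<in> c \<and> \<sigma> ` S0 b \<subseteq> \<pi> ` S \<and>
        c' = total_sim qo S `` {(b, the (model_map (S0 b) S \<pi> (\<sigma>, \<alpha>)))} \<and>
        c' \<in> comp_obj a S0 E qo S)"

definition comp_map ::
  "nat \<Rightarrow> (nat \<Rightarrow> 's set) \<Rightarrow> (nat \<Rightarrow> 'u set \<Rightarrow> ('u \<Rightarrow> nat) set) \<Rightarrow>
   ('u set \<Rightarrow> (nat \<times> ('s, 'u) elt) rel) \<Rightarrow> 'u set \<Rightarrow> ('u \<Rightarrow> 'u) \<Rightarrow>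
   (nat \<times> ('s, 'u) elt) set \<Rightarrow> (nat \<times> ('s, 'u) elt) set option" where
  "comp_map a S0 E qo S \<pi> c =
     (if \<exists>c'. comp_image a S0 E qo S \<pi> c c'
      then Some (THE c'. comp_image a S0 E qo S \<pi> c c') else None)"

text \<open>
  \<open>comp_obj\<close> is contravariant, so a permutation acts (on the left) through its inverse.
\<close>

definition sym_action ::
  "nat \<Rightarrow> (nat \<Rightarrow> 's set) \<Rightarrow> (nat \<Rightarrow> 'u set \<Rightarrow> ('u \<Rightarrow> nat) set) \<Rightarrow>
   ('u set \<Rightarrow> (nat \<times> ('s, 'u) elt) rel) \<Rightarrow> 'u set \<Rightarrow> ('u \<Rightarrow> 'u) \<Rightarrow>
   (nat \<times> ('s, 'u) elt) set \<Rightarrow> (nat \<times> ('s, 'u) elt) set" where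
  "sym_action a S0 E qo S \<pi> =
     (\<lambda>c \<in> comp_obj a S0 E qo S. the (comp_map a S0 E qo S (inv\<^bsub>BijGroup S\<^esub> \<pi>) c))"

definition periodic :: "(int \<Rightarrow> real) \<Rightarrow> bool" where
  "periodic c \<longleftrightarrow> (\<exists>p::int. p > 0 \<and> (\<forall>n. c (n + p) = c n))"

definition quasipolynomial :: "(int \<Rightarrow> real) \<Rightarrow> bool" where
  "quasipolynomial f \<longleftrightarrow>
     (\<exists>(d::nat) (c :: nat \<Rightarrow> int \<Rightarrow> real).
        (\<forall>i\<le>d. periodic (c i)) \<and> (\<forall>n. f n = (\<Sum>i\<le>d. c i n * of_int n ^ i)))"

end

theory Submission
  imports Defs "HOL-Computational_Algebra.Polynomial"
begin

text \<open>
  The \<open>Sym(S)\<close>-orbit of an element \<open>(\<sigma>, \<alpha>)\<close> is determined by the numbers \<open>m j\<close> of points outside the image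
  of \<open>\<sigma>\<close> that have colour \<open>j\<close>.  Comparable pairs are closed under deleting points outside both images
  (compatibility (3)), so by Dickson's lemma there is a threshold \<open>C\<close> such that a pair of colours occurring
  at least \<open>C\<close> times jointly may be repeated once more without leaving the quasi-order.  Hence maximality
  depends only on the truncation of \<open>m\<close> at some bound.  By axiom (3) equivalent elements have the same
  colour counts up to a partial permutation of colours and a bounded error.  Consequently, if a set \<open>U\<close> of
  colours dominates all others by a large gap, adding one point of every colour in \<open>U\<close> changes neither
  maximality nor the number of orbit types equivalent to \<open>m\<close>.

  The number of orbits on maximal classes is the sum over all \<open>m\<close> with a maximal class of
  \<open>1 / (number of types equivalent to m)\<close>.  Grouping the vectors \<open>m\<close> by the multiplicities of their
  superlevel sets \<open>{i. t \<le> m i}\<close>, this stability yields recursions \<open>f (n + card U) = f n + g n\<close>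
  and thus an eventually quasipolynomial count.
\<close>

section \<open>Eventually quasipolynomial sequences\<close>

text \<open>The weight 1 / (class size) avoids choosing one type per class: a chosen representative
  would have to be tracked while points are added, whereas the class size alone is stable. Adding a
  point of one frequent colour already preserves extendability to a larger index, but not class
  sizes: if two colours may be interchanged, the types (n, n) and (n + 1, n) have classes of size 1
  and 2. Adding a point to every colour of a superlevel set keeps all equalities and inequalities
  between the counts, and a large gap below that set survives the bounded error of passing to an
  equivalent type. This is why the sums are organised by superlevel sets and not by coordinates.
  Dickson's lemma only gives existence of thresholds, separately for each pair of indices and pair
  of colours; there are finitely many relevant combinations, so one threshold serves all.\<close>

definition residue_poly :: "nat \<Rightarrow> (nat \<Rightarrow> real) \<Rightarrow> bool" where
  "residue_poly L f \<longleftrightarrow> (\<forall>r. \<exists>P. \<forall>\<^sub>F t in sequentially. f (r + L * t) = poly P (real t))"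

definition ev_quasipoly :: "(nat \<Rightarrow> real) \<Rightarrow> bool" where
  "ev_quasipoly f \<longleftrightarrow> (\<exists>L>0. residue_poly L f)"

text \<open>The substitution t := M * t. It provides the common modulus that sums and
  antidifferences require.\<close>

lemma residue_poly_mult:
  assumes "residue_poly L f" and "M > 0"
  shows "residue_poly (L * M) f"
  unfolding residue_poly_def
proof
  fix r
  obtain P where P: "\<forall>\<^sub>F t in sequentially. f (r + L * t) = poly P (real t)"
    using assms(1) unfolding residue_poly_def by blast
  have "filterlim (\<lambda>t. M * t) at_top sequentially"
    using assms(2) by (intro mult_nat_left_at_top) auto
  then have "\<forall>\<^sub>F t in sequentially. f (r + L * (M * t)) = poly P (real (M * t))"
    using P by (rule eventually_compose_filterlim[rotated])
  then have "\<forall>\<^sub>F t in sequentially. f (r + L * M * t) = poly (P \<circ>\<^sub>p [:0, real M:]) (real t)"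
    by eventually_elim (simp add: poly_pcompose ac_simps)
  then show "\<exists>P. \<forall>\<^sub>F t in sequentially. f (r + L * M * t) = poly P (real t)" by blast
qed

lemma ev_quasipoly_add:
  assumes "ev_quasipoly f" "ev_quasipoly g"
  shows "ev_quasipoly (\<lambda>n. f n + g n)"
proof -
  obtain L M where LM: "L > 0" "residue_poly L f" "M > 0" "residue_poly M g"
    using assms unfolding ev_quasipoly_def by blast
  have "residue_poly (L * M) f" "residue_poly (L * M) g"
    using LM residue_poly_mult[of L f M] residue_poly_mult[of M g L] by (auto simp: mult.commute)
  have "\<exists>R. \<forall>\<^sub>F t in sequentially. f (r + L * M * t) + g (r + L * M * t) = poly R (real t)" for r
  proof -
    obtain P Q where "\<forall>\<^sub>F t in sequentially. f (r + L * M * t) = poly P (real t)"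
      "\<forall>\<^sub>F t in sequentially. g (r + L * M * t) = poly Q (real t)"
      using \<open>residue_poly (L * M) f\<close> \<open>residue_poly (L * M) g\<close> unfolding residue_poly_def by blast
    then have "\<forall>\<^sub>F t in sequentially. f (r + L * M * t) + g (r + L * M * t) = poly (P + Q) (real t)"
      by eventually_elim simp
    then show ?thesis by blast
  qed
  then have "residue_poly (L * M) (\<lambda>n. f n + g n)"
    unfolding residue_poly_def by blast
  moreover have "L * M > 0" using LM by simp
  ultimately show ?thesis unfolding ev_quasipoly_def by blast
qed

lemma ev_quasipoly_eventually_zero:
  assumes "\<And>n. n \<ge> N \<Longrightarrow> f n = 0"
  shows "ev_quasipoly f"
proof -
  have "\<forall>\<^sub>F t in sequentially. f (r + 1 * t) = poly 0 (real t)" for r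
    using assms by (auto simp: eventually_sequentially intro!: exI[of _ N])
  then have "residue_poly 1 f" unfolding residue_poly_def by blast
  then show ?thesis unfolding ev_quasipoly_def using zero_less_one by blast
qed

lemma ev_quasipoly_sum:
  assumes "\<And>x. x \<in> A \<Longrightarrow> ev_quasipoly (f x)"
  shows "ev_quasipoly (\<lambda>n. \<Sum>x\<in>A. f x n)"
proof (cases "finite A")
  case True
  then show ?thesis using assms
  proof (induction A)
    case empty
    then show ?case by (intro ev_quasipoly_eventually_zero[of 0]) simp
  next
    case (insert x A)
    then show ?case by (simp add: ev_quasipoly_add)
  qed
next
  case False
  then show ?thesis by (intro ev_quasipoly_eventually_zero[of 0]) simp
qed

text \<open>Immediate because \<open>residue_poly\<close> quantifies over all offsets r and not only
  over residues below L.\<close>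

lemma ev_quasipoly_shift:
  assumes "ev_quasipoly f"
  shows "ev_quasipoly (\<lambda>n. f (n + a))"
proof -
  obtain L where L: "L > 0" "residue_poly L f"
    using assms unfolding ev_quasipoly_def by blast
  have "\<exists>P. \<forall>\<^sub>F t in sequentially. f (r + L * t + a) = poly P (real t)" for r
    using L(2)[unfolded residue_poly_def, rule_format, of "r + a"] by (simp add: ac_simps)
  then show ?thesis using L(1) unfolding ev_quasipoly_def residue_poly_def by blast
qed

section \<open>Antidifferences of polynomials and of eventually quasipolynomial sequences\<close>

lemma degree_monom_difference:
  fixes d :: nat
  defines "Q \<equiv> [:1, 1:] ^ Suc d - monom (1::real) (Suc d)"
  shows "degree Q \<le> d" and "coeff Q d = real (Suc d)"
proof -
  have c: "coeff ([:1, 1:] ^ Suc d) i = (if i \<le> Suc d then real (Suc d choose i) else 0)" for i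
    using coeff_linear_poly_power[of i "Suc d" "1::real" 1] degree_linear_power[of "1::real" "Suc d"]
    by (cases "i \<le> Suc d") (auto intro: coeff_eq_0 simp del: power_Suc)
  show "degree Q \<le> d"
    unfolding Q_def by (rule degree_le) (auto simp: c simp del: power_Suc)
  show "coeff Q d = real (Suc d)" by (simp add: c Q_def del: power_Suc)
qed

text \<open>The difference of c * x^(d+1) has leading term c * (d+1) * x^d. With c chosen to match
  the leading coefficient of P, subtracting it lowers the degree.\<close>

lemma poly_antidifference:
  fixes P :: "real poly"
  shows "\<exists>R. \<forall>x. poly R (x + 1) - poly R x = poly P x"
proof (induction "degree P" arbitrary: P rule: less_induct)
  case less
  show ?case
  proof (cases "P = 0")
    case True
    then show ?thesis by (intro exI[of _ 0]) simp
  next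
    case False
    define d where "d = degree P"
    define c where "c = lead_coeff P / real (Suc d)"
    define Q where "Q = [:1, 1:] ^ Suc d - monom (1::real) (Suc d)"
    have dQ: "degree Q \<le> d" "coeff Q d = real (Suc d)"
      using degree_monom_difference[of d] unfolding Q_def by auto
    define P' where "P' = P - smult c Q"
    have "\<exists>R. \<forall>x. poly R (x + 1) - poly R x = poly P' x"
    \<comment> \<open>For d = 0 the remainder is 0 and its degree cannot drop, so this case must not
      go through the induction hypothesis.\<close>
    proof (cases "P' = 0")
      case True
      then show ?thesis by (intro exI[of _ 0]) simp
    next
      case P': False
      have le: "degree P' \<le> d" unfolding P'_def d_def
        using dQ by (intro degree_diff_le) (auto simp: d_def intro: order.trans[OF degree_smult_le])
      have "coeff P' d = 0" unfolding P'_def c_def using dQ(2) by (simp flip: d_def)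
      then have "degree P' \<noteq> d" using P' leading_coeff_0_iff by metis
      then show ?thesis using less le unfolding d_def by simp
    qed
    then obtain R where R: "\<And>x. poly R (x + 1) - poly R x = poly P' x" by blast
    have "poly (R + smult c (monom 1 (Suc d))) (x + 1) - poly (R + smult c (monom 1 (Suc d))) x
        = poly P x" for x
      using R[of x] unfolding P'_def Q_def by (simp add: poly_monom algebra_simps)
    then show ?thesis by blast
  qed
qed

text \<open>From N on, h and the antidifference R of P have equal increments, so they differ by the
  constant h N - R(N).\<close>

lemma ev_poly_antidifference:
  fixes h :: "nat \<Rightarrow> real"
  assumes "\<forall>\<^sub>F t in sequentially. h (Suc t) - h t = poly P (real t)"
  shows "\<exists>R. \<forall>\<^sub>F t in sequentially. h t = poly R (real t)"
proof -
  obtain R where R: "\<And>x. poly R (x + 1) - poly R x = poly P x"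
    using poly_antidifference by blast
  obtain N where N: "\<And>t. t \<ge> N \<Longrightarrow> h (Suc t) - h t = poly P (real t)"
    using assms unfolding eventually_sequentially by blast
  have "h t = poly (R + [:h N - poly R (real N):]) (real t)" if "t \<ge> N" for t
    using that
  proof (induction t rule: dec_induct)
    case base
    then show ?case by simp
  next
    case (step t)
    then show ?case using N[of t] R[of "real t"] by (simp add: add.commute)
  qed
  then show ?thesis unfolding eventually_sequentially by blast
qed

text \<open>Iterating the recursion L times moves the argument by L * a. Along a progression of that
  step, each of the L increments of f is eventually polynomial, so f has eventually polynomial
  differences there.\<close>

lemma ev_quasipoly_antidifference:
  assumes g: "ev_quasipoly g" and "a > 0" and f: "\<And>n. f (n + a) = f n + g n"
  shows "ev_quasipoly f"
proof -
  obtain L where L: "L > 0" "residue_poly L g"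
    using g unfolding ev_quasipoly_def by blast
  have La: "residue_poly (L * a) g"
    using residue_poly_mult[OF L(2) \<open>a > 0\<close>] .
  have iter: "f (n + a * M) = f n + (\<Sum>i<M. g (n + a * i))" for n M
  proof (induction M)
    case (Suc M)
    have "f (n + a * Suc M) = f ((n + a * M) + a)" by (simp add: algebra_simps)
    then show ?case using Suc f by simp
  qed simp
  have "\<exists>R. \<forall>\<^sub>F t in sequentially. f (r + L * a * t) = poly R (real t)" for r
  proof -
    have "\<exists>P. \<forall>\<^sub>F t in sequentially. g ((r + a * i) + L * a * t) = poly P (real t)" for i
      using La unfolding residue_poly_def by blast
    then obtain P where P: "\<And>i. \<forall>\<^sub>F t in sequentially. g ((r + a * i) + L * a * t) = poly (P i) (real t)"
      by metis
    then have "\<forall>\<^sub>F t in sequentially. \<forall>i\<in>{..<L}. g ((r + a * i) + L * a * t) = poly (P i) (real t)"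
      by (intro eventually_ball_finite) auto
    then have "\<forall>\<^sub>F t in sequentially. f (r + L * a * Suc t) - f (r + L * a * t)
        = poly (\<Sum>i<L. P i) (real t)"
    proof eventually_elim
      case (elim t)
      have "f (r + L * a * Suc t) = f ((r + L * a * t) + a * L)"
        by (simp add: algebra_simps)
      also have "\<dots> = f (r + L * a * t) + (\<Sum>i<L. g ((r + L * a * t) + a * i))"
        by (rule iter)
      also have "(\<Sum>i<L. g ((r + L * a * t) + a * i)) = (\<Sum>i<L. poly (P i) (real t))"
        using elim by (intro sum.cong) (auto simp: ac_simps)
      finally show ?case by (simp add: poly_sum)
    qed
    then show ?thesis by (rule ev_poly_antidifference[where h = "\<lambda>t. f (r + L * a * t)"])
  qed
  then have "residue_poly (L * a) f" unfolding residue_poly_def by blast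
  moreover have "L * a > 0" using L(1) \<open>a > 0\<close> by simp
  ultimately show ?thesis unfolding ev_quasipoly_def by blast
qed

lemma ev_quasipoly_imp_quasipolynomial:
  assumes "ev_quasipoly f"
  shows "\<exists>q. quasipolynomial q \<and> (\<exists>N. \<forall>n\<ge>N. f n = q (int n))"
proof -
  obtain L where L: "L > 0" "residue_poly L f"
    using assms unfolding ev_quasipoly_def by blast
  then obtain P where P: "\<And>r. \<forall>\<^sub>F t in sequentially. f (r + L * t) = poly (P r) (real t)"
    unfolding residue_poly_def by metis
  then have "\<forall>\<^sub>F t in sequentially. \<forall>r\<in>{..<L}. f (r + L * t) = poly (P r) (real t)"
    by (intro eventually_ball_finite) auto
  then obtain N where N: "\<And>t r. t \<ge> N \<Longrightarrow> r < L \<Longrightarrow> f (r + L * t) = poly (P r) (real t)"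
    unfolding eventually_sequentially by blast
  \<comment> \<open>\<open>P r\<close> is a polynomial in the quotient t; substituting t = (n - r) /
    L makes it one in n. Its coefficients, selected by the residue of n, become the periodic
    functions \<open>c i\<close>.\<close>
  define R where "R r = P r \<circ>\<^sub>p [:- real r / real L, 1 / real L:]" for r
  define d where "d = Max ((\<lambda>r. degree (R r)) ` {..<L})"
  define c where "c i n = coeff (R (nat (n mod int L))) i" for i and n :: int
  define q where "q n = (\<Sum>i\<le>d. c i n * of_int n ^ i)" for n
  have "periodic (c i)" for i
    unfolding periodic_def c_def using L(1) by (intro exI[of _ "int L"]) auto
  then have "quasipolynomial q" unfolding quasipolynomial_def q_def by blast
  moreover have "f n = q (int n)" if n: "n \<ge> N * L" for n
  proof -
    define r t where "r = n mod L" and "t = n div L"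
    have r: "r < L" and n_eq: "n = r + L * t" using L(1) by (auto simp: r_def t_def)
    have "t \<ge> N" using n L(1) by (simp add: t_def less_eq_div_iff_mult_less_eq)
    then have "f n = poly (P r) (real t)" using N r n_eq by blast
    also have "real t = - real r / real L + real n / real L"
      using L(1) by (simp add: n_eq field_simps)
    also have "poly (P r) \<dots> = poly (R r) (real n)"
      by (simp add: R_def poly_pcompose)
    also have "\<dots> = (\<Sum>i\<le>d. coeff (R r) i * real n ^ i)"
    proof -
      have "degree (R r) \<le> d" unfolding d_def using r by (intro Max_ge) auto
      then show ?thesis 
        unfolding poly_altdef by (intro sum.mono_neutral_left) (auto simp: coeff_eq_0)
    qed
    also have "\<dots> = q (int n)"
      by (simp add: q_def c_def r_def flip: zmod_int)
    finally show ?thesis .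
  qed
  ultimately show ?thesis by blast
qed

section \<open>Weighted sums over compositions\<close>

text \<open>The summand s is the number of points occupied by the image of \<sigma>. Vanishing
  outside I makes a vector of colour counts a unique function, and n < s gives the empty set without
  truncated subtraction.\<close>

definition comps :: "nat set \<Rightarrow> nat \<Rightarrow> nat \<Rightarrow> (nat \<Rightarrow> nat) set" where
  "comps I s n = {m. (\<forall>i. i \<notin> I \<longrightarrow> m i = 0) \<and> s + sum m I = n}"

text \<open>The superlevel sets of m form a chain, and \<open>lev\<close> counts how often each
  occurs, as in the conjugate of a partition. The threshold t = 0 is excluded since its superlevel
  set is always I. For U = {} and finite I the set is infinite and \<open>lev\<close> has the
  default value 0, hence the nonemptiness conditions below.\<close>

definition levels :: "nat set \<Rightarrow> nat set \<Rightarrow> (nat \<Rightarrow> nat) \<Rightarrow> nat set" where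
  "levels I U m = {t. 1 \<le> t \<and> {i\<in>I. t \<le> m i} = U}"

definition lev :: "nat set \<Rightarrow> nat set \<Rightarrow> (nat \<Rightarrow> nat) \<Rightarrow> nat" where
  "lev I U m = card (levels I U m)"

definition raise :: "nat set \<Rightarrow> (nat \<Rightarrow> nat) \<Rightarrow> nat \<Rightarrow> nat" where
  "raise U m = (\<lambda>i. if i \<in> U then Suc (m i) else m i)"

lemma finite_comps:
  assumes "finite I"
  shows "finite (comps I s n)"
proof (rule finite_subset)
  show "comps I s n \<subseteq> {f. \<forall>i. (i \<in> I \<longrightarrow> f i \<in> {..n}) \<and> (i \<notin> I \<longrightarrow> f i = 0)}"
    using assms by (auto simp: comps_def intro: trans_le_add2 member_le_sum)
  show "finite {f. \<forall>i. (i \<in> I \<longrightarrow> f i \<in> {..n}) \<and> (i \<notin> I \<longrightarrow> f i = 0)}"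
    using assms by (intro finite_set_of_finite_funs) auto
qed

lemma levels_subset:
  assumes "i \<in> U"
  shows "levels I U m \<subseteq> {1..m i}"
  using assms by (auto simp: levels_def)

lemma finite_levels:
  assumes "U \<noteq> {}"
  shows "finite (levels I U m)"
  using assms levels_subset[of _ U I m] finite_subset by (metis all_not_in_conv finite_atLeastAtMost)

text \<open>Sort the thresholds 1, ..., m i by their superlevel sets. In particular the
  multiplicities determine m on I.\<close>

lemma lev_sum:
  assumes "finite I" "i \<in> I"
  shows "m i = (\<Sum>U\<in>{U\<in>Pow I. i \<in> U}. lev I U m)"
proof -
  let ?F = "{U\<in>Pow I. i \<in> U}"
  have "{1..m i} = (\<Union>U\<in>?F. levels I U m)"
  proof
    show "{1..m i} \<subseteq> (\<Union>U\<in>?F. levels I U m)"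
    proof
      fix t assume "t \<in> {1..m i}"
      then have "{i\<in>I. t \<le> m i} \<in> ?F" "t \<in> levels I {i\<in>I. t \<le> m i} m"
        using assms(2) by (simp_all add: levels_def)
      then show "t \<in> (\<Union>U\<in>?F. levels I U m)" by (rule UN_I)
    qed
    show "(\<Union>U\<in>?F. levels I U m) \<subseteq> {1..m i}"
      using levels_subset by (intro UN_least) simp
  qed
  then have "card {1..m i} = card (\<Union>U\<in>?F. levels I U m)"
    by (rule arg_cong)
  also have "\<dots> = (\<Sum>U\<in>?F. card (levels I U m))"
  proof (rule card_UN_disjoint)
    show "finite ?F" using assms(1) by simp
    show "\<forall>U\<in>?F. finite (levels I U m)" using finite_levels by blast
    show "\<forall>U\<in>?F. \<forall>V\<in>?F. U \<noteq> V \<longrightarrow> levels I U m \<inter> levels I V m = {}"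
      unfolding levels_def by blast
  qed
  finally show ?thesis by (simp only: card_atLeastAtMost diff_Suc_1 lev_def)
qed

text \<open>Raising a set that already is a superlevel set duplicates one of its levels: levels up
  to \<open>t0\<close> stay, those from \<open>t0\<close> on move up by one.\<close>

lemma lev_raise:
  assumes "0 < lev I U m" "U \<noteq> {}" "V \<noteq> {}"
  shows "lev I V (raise U m) = lev I V m + (if V = U then 1 else 0)"
proof -
  obtain t0 where t0: "t0 \<in> levels I U m"
    using assms(1) unfolding lev_def by fastforce
  then have t01: "1 \<le> t0" and U: "{i\<in>I. t0 \<le> m i} = U" by (auto simp: levels_def)
  have low: "{i\<in>I. t \<le> raise U m i} = {i\<in>I. t \<le> m i}" if "t \<le> t0" for t
    using that U by (auto simp: raise_def)
  have high: "{i\<in>I. Suc t \<le> raise U m i} = {i\<in>I. t \<le> m i}" if "t0 \<le> t" for t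
    using that U by (auto simp: raise_def)
  \<comment> \<open>The level \<open>t0\<close> is counted on both sides; this overlap is the
    additional level of U.\<close>
  let ?A = "{t\<in>levels I V m. t \<le> t0}" and ?B = "{t\<in>levels I V m. t0 \<le> t}"
  have "levels I V (raise U m) = ?A \<union> Suc ` ?B"
  proof (intro Set.set_eqI iffI)
    fix t assume t: "t \<in> levels I V (raise U m)"
    show "t \<in> ?A \<union> Suc ` ?B"
    proof (cases "t \<le> t0")
      case True
      then show ?thesis using t low by (auto simp: levels_def)
    next
      case False
      then obtain t' where t': "t = Suc t'" "t0 \<le> t'" by (cases t) auto
      then have "t' \<in> ?B" using t high[of t'] t01 by (auto simp: levels_def)
      then show ?thesis using t' by blast
    qed
  next
    fix t assume "t \<in> ?A \<union> Suc ` ?B"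
    then show "t \<in> levels I V (raise U m)"
      using low high t01 by (auto simp: levels_def)
  qed
  moreover have "finite ?A" "finite ?B" using finite_levels[OF assms(3)] by auto
  moreover have "?A \<inter> Suc ` ?B = {}" by auto
  ultimately have "lev I V (raise U m) = card ?A + card (Suc ` ?B)"
    unfolding lev_def by (simp add: card_Un_disjoint)
  also have "\<dots> = card ?A + card ?B" by (simp add: card_image)
  also have "\<dots> = card (?A \<union> ?B) + card (?A \<inter> ?B)"
    using \<open>finite ?A\<close> \<open>finite ?B\<close> by (rule card_Un_Int)
  also have "?A \<union> ?B = levels I V m" by auto
  also have "?A \<inter> ?B = (if V = U then {t0} else {})"
    using t0 by (auto simp: levels_def)
  finally show ?thesis by (simp add: lev_def)
qed

lemma lev_le:
  assumes "i \<in> U"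
  shows "lev I U m \<le> m i"
  using card_mono[OF _ levels_subset[OF assms, of I m]] by (simp add: lev_def)

text \<open>Every threshold with superlevel set U lies above m j and not above m i, so the
  multiplicity bounds the gap from below.\<close>

lemma lev_le_diff:
  assumes "0 < lev I U m" "i \<in> U" "j \<in> I - U"
  shows "m j + lev I U m \<le> m i"
proof -
  have "levels I U m \<subseteq> {Suc (m j)..m i}"
    using assms(2,3) by (auto simp: levels_def not_less_eq_eq)
  then have "lev I U m \<le> m i - m j"
    using card_mono[of "{Suc (m j)..m i}"] by (fastforce simp: lev_def)
  then show ?thesis using assms(1) by linarith
qed

lemma lev_lower:
  assumes "2 \<le> lev I U m" "U \<noteq> {}"
  obtains m' where "m = raise U m'" "0 < lev I U m'"
proof
  define m' where "m' = (\<lambda>i. if i \<in> U then m i - 1 else m i)"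
  show "m = raise U m'"
    using lev_le[of _ U I m] assms(1) by (force simp: m'_def raise_def)
  \<comment> \<open>The smaller of two levels survives the lowering, because m i \<ge> t' > t for i
    in U.\<close>
  obtain t t' where t: "t \<in> levels I U m" "t' \<in> levels I U m" "t < t'"
    using assms(1) unfolding lev_def
    by (metis card_le_Suc0_iff_eq finite_levels[OF assms(2)] linorder_neqE_nat not_less_eq_eq numeral_2_eq_2)
  have "t \<in> levels I U m'"
  proof -
    have "t \<le> m' i \<longleftrightarrow> i \<in> U" if "i \<in> I" for i
    proof -
      have "t \<le> m i \<longleftrightarrow> i \<in> U" "t' \<le> m i \<longleftrightarrow> i \<in> U"
        using t that by (auto simp: levels_def)
      then show ?thesis using t(3) by (auto simp: m'_def)
    qed
    moreover have "U \<subseteq> I" using t by (auto simp: levels_def)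
    ultimately show ?thesis using t(1) by (auto simp: levels_def)
  qed
  then show "0 < lev I U m'"
    unfolding lev_def using finite_levels[OF assms(2)] card_gt_0_iff by blast
qed

lemma raise_in_comps_iff:
  assumes "finite I" "U \<subseteq> I"
  shows "raise U m \<in> comps I s (n + card U) \<longleftrightarrow> m \<in> comps I s n"
proof -
  have "sum (raise U m) I = sum (\<lambda>i. m i + (if i \<in> U then 1 else 0)) I"
    by (intro sum.cong) (auto simp: raise_def)
  also have "\<dots> = sum m I + card (I \<inter> U)"
    using assms(1) by (simp add: sum.distrib sum.If_cases)
  also have "I \<inter> U = U" using assms(2) by auto
  finally show ?thesis using assms(2) by (auto simp: comps_def raise_def)
qed

lemma raise_inj: "inj (raise U)"
proof
  fix m m' assume "raise U m = raise U m'"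
  then have "raise U m i = raise U m' i" for i by simp
  then show "m = m'" by (intro ext) (metis nat.inject raise_def)
qed

text \<open>Induction on the set X of those nonempty U whose multiplicity is still free; the
  multiplicities outside X are prescribed by c. Freeing one more U costs one antidifference of step
  \<open>card U\<close>.\<close>

lemma ev_quasipoly_stable_sum:
  fixes w :: "(nat \<Rightarrow> nat) \<Rightarrow> real"
  assumes I: "finite I" and "0 < C"
    and stable: "\<And>m U. \<lbrakk>U \<subseteq> I; U \<noteq> {}; \<forall>i. i \<notin> I \<longrightarrow> m i = 0; C \<le> lev I U m\<rbrakk> \<Longrightarrow> w (raise U m) = w m"
  shows "ev_quasipoly (\<lambda>n. \<Sum>m\<in>comps I s n. w m)"
proof -
  let ?P = "Pow I - {{}}"
  define A where "A X c n = {m\<in>comps I s n. \<forall>U\<in>?P - X. lev I U m = c U}" for X c n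
  have finA: "finite (A X c n)" for X c n
    unfolding A_def using finite_comps[OF I] by simp
  have "ev_quasipoly (\<lambda>n. \<Sum>m\<in>A X c n. w m)" if "finite X" "X \<subseteq> ?P" for X c
    using that
  proof (induction X arbitrary: c rule: finite_induct)
    case empty
    \<comment> \<open>With all multiplicities prescribed, \<open>lev_sum\<close> reconstructs m and
      hence n, so the sum is empty for all but at most one n.\<close>
    have uniq: "m = m'" if "m \<in> A {} c n" "m' \<in> A {} c n'" for m m' n n'
    proof
      fix i
      show "m i = m' i"
      proof (cases "i \<in> I")
        case True
        have "lev I U m = lev I U m'" if "U \<in> {U\<in>Pow I. i \<in> U}" for U
        proof -
          have "U \<in> ?P - {}" using that by auto
          then show ?thesis using \<open>m \<in> A {} c n\<close> \<open>m' \<in> A {} c n'\<close> unfolding A_def by simp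
        qed
        then show ?thesis
          unfolding lev_sum[OF I True, of m] lev_sum[OF I True, of m'] by (rule sum.cong[OF refl])
      next
        case False
        then show ?thesis using that by (simp add: A_def comps_def)
      qed
    qed
    have "\<exists>N. \<forall>n\<ge>N. A {} c n = {}"
    proof (cases "\<exists>m n. m \<in> A {} c n")
      case True
      then obtain m n where m: "m \<in> A {} c n" by blast
      then have "A {} c n' = {}" if "n' \<ge> Suc n" for n'
        using uniq[OF m, of _ n'] that by (fastforce simp: A_def comps_def)
      then show ?thesis by blast
    qed auto
    then obtain N where "\<And>n. n \<ge> N \<Longrightarrow> A {} c n = {}" by blast
    then show ?case by (intro ev_quasipoly_eventually_zero[of N]) simp
  next
    case (insert U X)
    then have U: "U \<subseteq> I" "U \<noteq> {}" and finU: "finite U"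
      using I finite_subset by auto
    \<comment> \<open>Multiplicities of U below C are handled by finitely many instances of the
      induction hypothesis; \<open>B\<close> collects the rest, where \<open>stable\<close>
      applies.\<close>
    define B where "B n = {m\<in>A (insert U X) c n. C \<le> lev I U m}" for n
    have IH: "ev_quasipoly (\<lambda>n. \<Sum>m\<in>A X (c(U := v)) n. w m)" for v
      using insert by simp
    have A_upd: "A X (c(U := v)) n = {m\<in>A (insert U X) c n. lev I U m = v}" for v n
      using insert.hyps(2) U by (auto simp: A_def)
    have split: "A (insert U X) c n = (\<Union>v\<in>{..<C}. A X (c(U := v)) n) \<union> B n" for n
      unfolding A_upd B_def by auto
    have "(\<Sum>m\<in>A (insert U X) c n. w m)
        = (\<Sum>v<C. \<Sum>m\<in>A X (c(U := v)) n. w m) + (\<Sum>m\<in>B n. w m)" for n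
    proof -
      have "(\<Sum>m\<in>A (insert U X) c n. w m)
          = (\<Sum>m\<in>(\<Union>v\<in>{..<C}. A X (c(U := v)) n). w m) + (\<Sum>m\<in>B n. w m)"
        unfolding split
        by (intro sum.union_disjoint) (auto simp: finA A_upd B_def)
      also have "(\<Sum>m\<in>(\<Union>v\<in>{..<C}. A X (c(U := v)) n). w m)
          = (\<Sum>v<C. \<Sum>m\<in>A X (c(U := v)) n. w m)"
        by (intro sum.UNION_disjoint) (auto simp: finA, auto simp: A_upd)
      finally show ?thesis .
    qed
    moreover have "ev_quasipoly (\<lambda>n. \<Sum>m\<in>B n. w m)"
    proof (rule ev_quasipoly_antidifference)
      show "ev_quasipoly (\<lambda>n. \<Sum>m\<in>A X (c(U := C)) (n + card U). w m)"
        by (rule ev_quasipoly_shift[OF IH])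
      show "0 < card U" using U finU by (simp add: card_gt_0_iff)
      fix n
      have lev_r: "lev I V (raise U m) = lev I V m + (if V = U then 1 else 0)"
        if "V \<noteq> {}" "C \<le> lev I U m" for V m
        using lev_raise[of I U m V] U that \<open>0 < C\<close> by simp
      \<comment> \<open>\<open>raise U\<close> adds one to the multiplicity of U and fixes the
        others, so it maps \<open>B n\<close> onto the vectors with multiplicity above C. Those with
        multiplicity exactly C supply the inhomogeneous term of the recursion. By
        \<open>0 < C\<close>, U is a superlevel set before raising and remains one after
        lowering.\<close>
      have "B (n + card U) = raise U ` B n \<union> A X (c(U := C)) (n + card U)"
      proof (intro Set.set_eqI iffI)
        fix m assume m: "m \<in> B (n + card U)"
        show "m \<in> raise U ` B n \<union> A X (c(U := C)) (n + card U)"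
        proof (cases "lev I U m = C")
          case True
          then show ?thesis using m by (simp add: A_upd B_def)
        next
          case False
          then have "2 \<le> lev I U m" "C < lev I U m"
            using m \<open>0 < C\<close> by (auto simp: B_def)
          then obtain m' where m': "m = raise U m'" "0 < lev I U m'"
            using lev_lower U(2) by metis
          then have l: "lev I V m = lev I V m' + (if V = U then 1 else 0)" if "V \<noteq> {}" for V
            using lev_raise U(2) that by blast
          have "m' \<in> comps I s n"
            using m m'(1) raise_in_comps_iff[OF I U(1)] by (simp add: A_def B_def)
          moreover have "lev I V m' = c V" if "V \<in> ?P - insert U X" for V
            using m l[of V] that by (auto simp: A_def B_def)
          moreover have "C \<le> lev I U m'"
            using \<open>C < lev I U m\<close> l[OF U(2)] by simp
          ultimately have "m' \<in> B n" by (simp add: A_def B_def)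
          then show ?thesis using m' by blast
        qed
      next
        fix m assume "m \<in> raise U ` B n \<union> A X (c(U := C)) (n + card U)"
        then show "m \<in> B (n + card U)"
        proof
          assume "m \<in> raise U ` B n"
          then obtain m' where m': "m' \<in> B n" "m = raise U m'" by blast
          then show ?thesis
            using raise_in_comps_iff[OF I U(1)] lev_r U by (auto simp: A_def B_def)
        next
          assume "m \<in> A X (c(U := C)) (n + card U)"
          then show ?thesis by (simp add: A_upd B_def)
        qed
      qed
      moreover have "raise U ` B n \<inter> A X (c(U := C)) (n + card U) = {}"
      proof -
        have "lev I U (raise U m) \<noteq> C" if "m \<in> B n" for m
          using lev_r[OF U(2), of m] that by (simp add: B_def)
        then show ?thesis by (auto simp: A_upd)
      qed
      ultimately have "(\<Sum>m\<in>B (n + card U). w m)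
          = (\<Sum>m\<in>raise U ` B n. w m) + (\<Sum>m\<in>A X (c(U := C)) (n + card U). w m)"
        using finA by (simp add: sum.union_disjoint B_def)
      also have "(\<Sum>m\<in>raise U ` B n. w m) = (\<Sum>m\<in>B n. w (raise U m))"
        by (simp add: sum.reindex inj_on_subset[OF raise_inj])
      also have "\<dots> = (\<Sum>m\<in>B n. w m)"
        using stable U by (intro sum.cong) (auto simp: B_def A_def comps_def)
      finally show "(\<Sum>m\<in>B (n + card U). w m)
          = (\<Sum>m\<in>B n. w m) + (\<Sum>m\<in>A X (c(U := C)) (n + card U). w m)" .
    qed
    ultimately show ?case
      using IH by (simp add: ev_quasipoly_add ev_quasipoly_sum)
  qed
  from this[of ?P] have "ev_quasipoly (\<lambda>n. \<Sum>m\<in>A ?P c n. w m)" for c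
    using I by simp
  then show ?thesis by (simp add: A_def)
qed

section \<open>Extending comparable pairs by a point\<close>

lemma nat_seq_mono_subseq:
  fixes g :: "nat \<Rightarrow> nat"
  shows "\<exists>\<phi> :: nat \<Rightarrow> nat. strict_mono \<phi> \<and> mono (g \<circ> \<phi>)"
proof -
  have ex: "\<exists>x>n. \<forall>y>n. g x \<le> g y" for n
    using ex_has_least_nat[of "\<lambda>x. x > n" "Suc n" g] by auto
  \<comment> \<open>Each chosen index minimises g on the tail after some smaller p. The next index
    lies in that tail, which gives monotonicity.\<close>
  have "\<exists>\<phi>. \<forall>n. (\<exists>p. \<phi> n > p \<and> (\<forall>y>p. g (\<phi> n) \<le> g y)) \<and> \<phi> n < \<phi> (Suc n)"
  proof (rule dependent_nat_choice)
    show "\<exists>x. \<exists>p<x. \<forall>y>p. g x \<le> g y" using ex by blast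
    show "\<exists>y. (\<exists>p<y. \<forall>z>p. g y \<le> g z) \<and> x < y" for x using ex[of x] by blast
  qed
  then obtain \<phi> where \<phi>: "\<And>n. \<exists>p. \<phi> n > p \<and> (\<forall>y>p. g (\<phi> n) \<le> g y)" "\<And>n. \<phi> n < \<phi> (Suc n)"
    by blast
  have "g (\<phi> n) \<le> g (\<phi> (Suc n))" for n using \<phi>[of n] by (meson order.strict_trans)
  then have "mono (g \<circ> \<phi>)" by (intro mono_iff_le_Suc[THEN iffD2]) simp
  moreover have "strict_mono \<phi>" using \<phi>(2) by (simp add: strict_mono_Suc_iff)
  ultimately show ?thesis by blast
qed

lemma dickson_mono_subseq:
  fixes f :: "nat \<Rightarrow> 'l \<Rightarrow> nat"
  assumes "finite L"
  shows "\<exists>\<phi> :: nat \<Rightarrow> nat. strict_mono \<phi> \<and> (\<forall>l\<in>L. mono (\<lambda>n. f (\<phi> n) l))"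
  using assms
proof (induction L)
  case empty
  then show ?case by (intro exI[of _ id]) (simp add: strict_mono_def)
next
  case (insert l L)
  then obtain \<phi> :: "nat \<Rightarrow> nat" where \<phi>: "strict_mono \<phi>" "\<And>l'. l' \<in> L \<Longrightarrow> mono (\<lambda>n. f (\<phi> n) l')" by blast
  obtain \<psi> :: "nat \<Rightarrow> nat" where \<psi>: "strict_mono \<psi>" "mono ((\<lambda>n. f (\<phi> n) l) \<circ> \<psi>)"
    using nat_seq_mono_subseq by blast
  have "strict_mono (\<phi> \<circ> \<psi>)" using \<phi>(1) \<psi>(1) by (simp add: strict_mono_def)
  moreover have "mono (\<lambda>n. f ((\<phi> \<circ> \<psi>) n) l')" if "l' \<in> insert l L" for l'
  proof (cases "l' = l")
    case True
    then show ?thesis using \<psi>(2) by (simp add: o_def)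
  next
    case False
    then have "mono (\<lambda>n. f (\<phi> n) l')" using that \<phi>(2) by blast
    then show ?thesis using strict_mono_mono[OF \<psi>(1)] by (auto simp: mono_def)
  qed
  ultimately show ?case by blast
qed

text \<open>Choose an injection on each fibre and glue. This turns inequalities between label
  counts, as produced by Dickson's lemma, into an injection along which elements can be pulled
  back.\<close>

lemma fibrewise_injection:
  assumes "finite S" "finite T" and "\<And>l. card {u\<in>S. g u = l} \<le> card {u\<in>T. h u = l}"
  shows "\<exists>\<pi>. inj_on \<pi> S \<and> \<pi> ` S \<subseteq> T \<and> (\<forall>u\<in>S. h (\<pi> u) = g u)"
proof -
  have "\<exists>f. f ` {u\<in>S. g u = l} \<subseteq> {u\<in>T. h u = l} \<and> inj_on f {u\<in>S. g u = l}" for l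
    using assms by (intro card_le_inj) auto
  then have "\<exists>f. \<forall>l. f l ` {u\<in>S. g u = l} \<subseteq> {u\<in>T. h u = l} \<and> inj_on (f l) {u\<in>S. g u = l}"
    by (intro choice allI)
  then obtain f where f': "\<forall>l. f l ` {u\<in>S. g u = l} \<subseteq> {u\<in>T. h u = l} \<and> inj_on (f l) {u\<in>S. g u = l}" ..
  then have f: "\<And>l. f l ` {u\<in>S. g u = l} \<subseteq> {u\<in>T. h u = l}" "\<And>l. inj_on (f l) {u\<in>S. g u = l}"
    by simp_all
  have fu: "f (g u) u \<in> T \<and> h (f (g u) u) = g u" if "u \<in> S" for u
    using f(1)[of "g u"] that by auto
  have "inj_on (\<lambda>u. f (g u) u) S"
  proof (rule inj_onI)
    fix u v assume uv: "u \<in> S" "v \<in> S" "f (g u) u = f (g v) v"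
    then have "g u = g v" using fu by metis
    then show "u = v" using uv f(2)[of "g u"] by (auto simp: inj_on_def)
  qed
  then show ?thesis using fu by (intro exI[of _ "\<lambda>u. f (g u) u"]) auto
qed

text \<open>Recognises a pull-back from its values: no inverse of \<pi> has to be computed, and
  extensionality settles the values off the domains.\<close>

lemma model_map_eq:
  assumes "\<sigma> \<in> injections S0 S" "\<alpha> \<in> extensional (S - \<sigma> ` S0)" "inj_on \<pi> S"
    and "\<And>e. e \<in> S0 \<Longrightarrow> \<sigma>' e = \<pi> (\<sigma> e)" and "\<And>u. u \<in> S - \<sigma> ` S0 \<Longrightarrow> \<alpha>' (\<pi> u) = \<alpha> u"
  shows "model_map S0 S \<pi> (\<sigma>', \<alpha>') = Some (\<sigma>, \<alpha>)"
proof -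
  have mem: "\<sigma> e \<in> S" if "e \<in> S0" for e using assms(1) that by (auto simp: injections_def)
  have "compose S0 (inv_into S \<pi>) \<sigma>' = \<sigma>"
  proof
    fix e
    show "compose S0 (inv_into S \<pi>) \<sigma>' e = \<sigma> e"
      using assms(1,3,4) mem by (cases "e \<in> S0") (auto simp: compose_def injections_def)
  qed
  moreover have "compose (S - \<sigma> ` S0) \<alpha>' \<pi> = \<alpha>"
    using assms(2,5) by (auto simp: compose_def extensional_def fun_eq_iff)
  moreover have "\<sigma>' ` S0 \<subseteq> \<pi> ` S" using assms(4) mem by auto
  ultimately show ?thesis by (simp add: model_map_def Let_def)
qed

definition colour_count :: "'s set \<Rightarrow> 'u set \<Rightarrow> ('s \<Rightarrow> 'u) \<Rightarrow> ('u \<Rightarrow> nat) \<Rightarrow> nat \<Rightarrow> nat" where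
  "colour_count S0 S \<sigma> \<alpha> j = card {u \<in> S - \<sigma> ` S0. \<alpha> u = j}"

lemma colour_count_insert:
  assumes "finite S" "s \<notin> S" "\<sigma> \<in> injections S0 S"
  shows "colour_count S0 (insert s S) \<sigma> (\<alpha>(s := i))
    = (colour_count S0 S \<sigma> \<alpha>)(i := Suc (colour_count S0 S \<sigma> \<alpha> i))"
proof
  fix j
  have s: "s \<notin> \<sigma> ` S0" using assms by (auto simp: injections_def)
  have "{u \<in> insert s S - \<sigma> ` S0. (\<alpha>(s := i)) u = j}
      = (if j = i then insert s {u \<in> S - \<sigma> ` S0. \<alpha> u = j} else {u \<in> S - \<sigma> ` S0. \<alpha> u = j})"
    using s assms(2) by auto
  then show "colour_count S0 (insert s S) \<sigma> (\<alpha>(s := i)) j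
      = ((colour_count S0 S \<sigma> \<alpha>)(i := Suc (colour_count S0 S \<sigma> \<alpha> i))) j"
    using assms(1,2) by (simp add: colour_count_def)
qed

definition joint_count ::
  "'s set \<Rightarrow> 's set \<Rightarrow> 'u set \<Rightarrow> ('s \<Rightarrow> 'u) \<Rightarrow> ('u \<Rightarrow> nat) \<Rightarrow> ('s \<Rightarrow> 'u) \<Rightarrow> ('u \<Rightarrow> nat) \<Rightarrow> nat \<times> nat \<Rightarrow> nat" where
  "joint_count S0 S0' S \<sigma> \<alpha> \<tau> \<beta> = (\<lambda>(i, j). card {u \<in> S - \<sigma> ` S0 - \<tau> ` S0'. \<alpha> u = i \<and> \<beta> u = j})"

lemma joint_count_insert:
  assumes "finite S" "s \<notin> S" "\<sigma> \<in> injections S0 S" "\<tau> \<in> injections S0' S"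
  shows "joint_count S0 S0' (insert s S) \<sigma> (\<alpha>(s := i)) \<tau> (\<beta>(s := j))
    = (joint_count S0 S0' S \<sigma> \<alpha> \<tau> \<beta>)((i, j) := Suc (joint_count S0 S0' S \<sigma> \<alpha> \<tau> \<beta> (i, j)))"
proof
  fix p :: "nat \<times> nat"
  obtain i' j' where p: "p = (i', j')" by fastforce
  have s: "s \<notin> \<sigma> ` S0" "s \<notin> \<tau> ` S0'" using assms by (auto simp: injections_def)
  have "{u \<in> insert s S - \<sigma> ` S0 - \<tau> ` S0'. (\<alpha>(s := i)) u = i' \<and> (\<beta>(s := j)) u = j'}
      = (if (i', j') = (i, j) then insert s {u \<in> S - \<sigma> ` S0 - \<tau> ` S0'. \<alpha> u = i' \<and> \<beta> u = j'}
         else {u \<in> S - \<sigma> ` S0 - \<tau> ` S0'. \<alpha> u = i' \<and> \<beta> u = j'})"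
    using s assms(2) by auto
  then show "joint_count S0 S0' (insert s S) \<sigma> (\<alpha>(s := i)) \<tau> (\<beta>(s := j)) p
      = ((joint_count S0 S0' S \<sigma> \<alpha> \<tau> \<beta>)((i, j) := Suc (joint_count S0 S0' S \<sigma> \<alpha> \<tau> \<beta> (i, j)))) p"
    using assms(1,2) by (simp add: joint_count_def p)
qed

lemma injections_insert:
  "\<sigma> \<in> injections S0 S \<Longrightarrow> \<sigma> \<in> injections S0 (insert s S)"
  by (auto simp: injections_def)

text \<open>The infinite universe ensures that a fresh point can always be adjoined to a finite
  set.\<close>

locale infinite_compatible_quasi_orders = compatible_quasi_orders a S0 k E sim qo
  for a :: nat and S0 :: "nat \<Rightarrow> 's set" and k :: "nat \<Rightarrow> nat"
    and E :: "nat \<Rightarrow> 'u set \<Rightarrow> ('u \<Rightarrow> nat) set"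
    and sim :: "nat \<Rightarrow> 'u set \<Rightarrow> ('s, 'u) elt rel"
    and qo :: "'u set \<Rightarrow> (nat \<times> ('s, 'u) elt) rel" +
  assumes infinite_univ: "infinite (UNIV :: 'u set)"
begin

abbreviation obj :: "'u set \<Rightarrow> (nat \<times> ('s, 'u) elt) set" where
  "obj S \<equiv> total_obj a S0 E S"

lemma objD:
  assumes "finite S" "(b, \<sigma>, \<alpha>) \<in> obj S"
  shows "b \<in> {1..a}" "finite (S0 b)" "\<sigma> \<in> injections (S0 b) S"
    "\<alpha> \<in> (S - \<sigma> ` S0 b) \<rightarrow>\<^sub>E {1..k b}" "\<alpha> \<in> extensional (S - \<sigma> ` S0 b)"
proof -
  show b: "b \<in> {1..a}" and "\<sigma> \<in> injections (S0 b) S"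
    using assms(2) by (auto simp: total_obj_def model_obj_def)
  interpret m: model_functor "S0 b" "k b" "E b" "sim b" using model[OF b] .
  show "finite (S0 b)" by (rule m.finite_S0)
  show "\<alpha> \<in> (S - \<sigma> ` S0 b) \<rightarrow>\<^sub>E {1..k b}"
    using assms m.E_subset[of "S - \<sigma> ` S0 b"] by (auto simp: total_obj_def model_obj_def)
  then show "\<alpha> \<in> extensional (S - \<sigma> ` S0 b)" by (simp add: PiE_def)
qed

lemma qo_obj:
  assumes "finite S" "(x, y) \<in> qo S"
  shows "x \<in> obj S" "y \<in> obj S"
  using quasi_order[OF assms(1)] assms(2) by (auto simp: preorder_on_def)

lemma qo_refl: "finite S \<Longrightarrow> x \<in> obj S \<Longrightarrow> (x, x) \<in> qo S"
  using quasi_order by (auto simp: preorder_on_def refl_on_def)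

lemma qo_trans: "finite S \<Longrightarrow> (x, y) \<in> qo S \<Longrightarrow> (y, z) \<in> qo S \<Longrightarrow> (x, z) \<in> qo S"
  using quasi_order unfolding preorder_on_def by (metis transD)

text \<open>Compatibility (3) in usable form: a pair on S is comparable once some injection, given
  only by its values on S, exhibits it as the restriction of a comparable pair on T.\<close>

lemma qo_pullback:
  assumes fin: "finite S" "finite T" and qo: "((b, \<sigma>', \<alpha>'), (b', \<tau>', \<beta>')) \<in> qo T"
    and \<pi>: "inj_on \<pi> S" "\<pi> ` S \<subseteq> T"
    and \<sigma>: "\<sigma> \<in> injections (S0 b) S" "\<alpha> \<in> extensional (S - \<sigma> ` S0 b)"
      "\<And>e. e \<in> S0 b \<Longrightarrow> \<sigma>' e = \<pi> (\<sigma> e)" "\<And>u. u \<in> S - \<sigma> ` S0 b \<Longrightarrow> \<alpha>' (\<pi> u) = \<alpha> u"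
    and \<tau>: "\<tau> \<in> injections (S0 b') S" "\<beta> \<in> extensional (S - \<tau> ` S0 b')"
      "\<And>e. e \<in> S0 b' \<Longrightarrow> \<tau>' e = \<pi> (\<tau> e)" "\<And>u. u \<in> S - \<tau> ` S0 b' \<Longrightarrow> \<beta>' (\<pi> u) = \<beta> u"
  shows "((b, \<sigma>, \<alpha>), (b', \<tau>, \<beta>)) \<in> qo S"
proof -
  let ?\<rho> = "restrict \<pi> S"
  have \<rho>: "inj_on ?\<rho> S" using \<pi>(1) by (simp add: inj_on_def)
  then have inj: "?\<rho> \<in> injections S T" using \<pi>(2) by (auto simp: injections_def)
  have mem: "\<sigma> e \<in> S" if "e \<in> S0 b" for e using \<sigma>(1) that by (auto simp: injections_def)
  have mem': "\<tau> e \<in> S" if "e \<in> S0 b'" for e using \<tau>(1) that by (auto simp: injections_def)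
  have "model_map (S0 b) S ?\<rho> (\<sigma>', \<alpha>') = Some (\<sigma>, \<alpha>)"
    using \<sigma> mem by (intro model_map_eq[OF _ _ \<rho>]) auto
  moreover have "model_map (S0 b') S ?\<rho> (\<tau>', \<beta>') = Some (\<tau>, \<beta>)"
    using \<tau> mem' by (intro model_map_eq[OF _ _ \<rho>]) auto
  moreover have "\<sigma>' ` S0 b \<union> \<tau>' ` S0 b' \<subseteq> ?\<rho> ` S"
    using \<sigma>(3) \<tau>(3) mem mem' by auto
  ultimately show ?thesis using compat3[OF fin inj qo] by simp
qed

text \<open>Suppose every C had a bad pair. Dickson's lemma for label counts gives two bad pairs,
  the second having at least as many points of each label and strictly more points coloured (i, j)
  outside both images. Then the first pair together with its new point embeds into the second, so
  pulling back makes the extended pair comparable, a contradiction.\<close>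

lemma qo_insert:
  "\<exists>C. \<forall>S \<sigma> \<alpha> \<tau> \<beta> s. finite S \<and> ((b, \<sigma>, \<alpha>), (b', \<tau>, \<beta>)) \<in> qo S \<and> s \<notin> S \<and>
     C \<le> joint_count (S0 b) (S0 b') S \<sigma> \<alpha> \<tau> \<beta> (i, j) \<longrightarrow>
     ((b, \<sigma>, \<alpha>(s := i)), (b', \<tau>, \<beta>(s := j))) \<in> qo (insert s S)"
proof (rule ccontr)
  assume contr: "\<not> ?thesis"
  have "\<forall>C. \<exists>S \<sigma> \<alpha> \<tau> \<beta> s. finite S \<and> ((b, \<sigma>, \<alpha>), (b', \<tau>, \<beta>)) \<in> qo S \<and> s \<notin> S \<and>
     C \<le> joint_count (S0 b) (S0 b') S \<sigma> \<alpha> \<tau> \<beta> (i, j) \<and>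
     ((b, \<sigma>, \<alpha>(s := i)), (b', \<tau>, \<beta>(s := j))) \<notin> qo (insert s S)"
    using contr by (simp only: not_ex not_all not_imp conj_assoc simp_thms)
  then have "\<exists>S \<sigma> \<alpha> \<tau> \<beta> s. \<forall>C. finite (S C) \<and> ((b, \<sigma> C, \<alpha> C), (b', \<tau> C, \<beta> C)) \<in> qo (S C) \<and> s C \<notin> S C \<and>
     C \<le> joint_count (S0 b) (S0 b') (S C) (\<sigma> C) (\<alpha> C) (\<tau> C) (\<beta> C) (i, j) \<and>
     ((b, \<sigma> C, (\<alpha> C)(s C := i)), (b', \<tau> C, (\<beta> C)(s C := j))) \<notin> qo (insert (s C) (S C))"
    by (simp only: choice_iff)
  then obtain S \<sigma> \<alpha> \<tau> \<beta> s where fin: "\<And>C. finite (S C)"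
    and qo: "\<And>C. ((b, \<sigma> C, \<alpha> C), (b', \<tau> C, \<beta> C)) \<in> qo (S C)" and s: "\<And>C. s C \<notin> S C"
    and big: "\<And>C. C \<le> joint_count (S0 b) (S0 b') (S C) (\<sigma> C) (\<alpha> C) (\<tau> C) (\<beta> C) (i, j)"
    and bad: "\<And>C. ((b, \<sigma> C, (\<alpha> C)(s C := i)), (b', \<tau> C, (\<beta> C)(s C := j))) \<notin> qo (insert (s C) (S C))"
    by blast
  note x = objD[OF fin qo_obj(1)[OF fin qo]] and y = objD[OF fin qo_obj(2)[OF fin qo]]
  \<comment> \<open>A label records which elements of \<open>S0 b\<close> and \<open>S0 b'\<close>
    are sent to u, and both colours. At an image point the corresponding colour is
    \<open>undefined\<close> by extensionality, hence the extra value in \<open>L\<close>; the first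
    two components distinguish such points even if \<open>undefined\<close> equals a colour.\<close>
  define lab where "lab C u = ({e\<in>S0 b. \<sigma> C e = u}, {e\<in>S0 b'. \<tau> C e = u}, \<alpha> C u, \<beta> C u)" for C u
  define l0 :: "'s set \<times> 's set \<times> nat \<times> nat" where "l0 = ({}, {}, i, j)"
  define f where "f C l = card {u \<in> S C. lab C u = l}" for C l
  define L where "L = Pow (S0 b) \<times> Pow (S0 b') \<times> insert undefined {1..k b} \<times> insert undefined {1..k b'}"
  have "finite L" unfolding L_def using x(2) y(2) by simp
  have lab_L: "lab C u \<in> L" if "u \<in> S C" for C u
  proof -
    have "\<alpha> C u \<in> insert undefined {1..k b}"
      using x(4)[of C] x(5)[of C] that by (cases "u \<in> \<sigma> C ` S0 b") (auto simp: extensional_def)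
    moreover have "\<beta> C u \<in> insert undefined {1..k b'}"
      using y(4)[of C] y(5)[of C] that by (cases "u \<in> \<tau> C ` S0 b'") (auto simp: extensional_def)
    ultimately show ?thesis unfolding lab_def L_def by auto
  qed
  obtain \<phi> :: "nat \<Rightarrow> nat" where \<phi>: "strict_mono \<phi>" "\<And>l. l \<in> L \<Longrightarrow> mono (\<lambda>n. f (\<phi> n) l)"
    using dickson_mono_subseq[OF \<open>finite L\<close>, of f] by blast
  define p where "p = \<phi> 0"
  \<comment> \<open>Since \<phi> n \<ge> n, this index exceeds \<open>f p l0\<close>, and the bad
    pair number q has at least q points labelled \<open>l0\<close>. This makes the inequality at
    \<open>l0\<close> strict.\<close>
  define q where "q = \<phi> (Suc (f p l0))"
  have f_le: "f p l \<le> f q l" for l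
  proof (cases "l \<in> L")
    case True
    then show ?thesis using \<phi>(2)[of l] by (simp add: p_def q_def mono_def)
  next
    case False
    then have "{u \<in> S p. lab p u = l} = {}" using lab_L by blast
    then have "f p l = 0" unfolding f_def by (simp only: card.empty)
    then show ?thesis by simp
  qed
  have f_less: "f p l0 < f q l0"
  proof -
    have "f p l0 < q" unfolding q_def using strict_mono_imp_increasing[OF \<phi>(1), of "Suc (f p l0)"] by simp
    also have "q \<le> joint_count (S0 b) (S0 b') (S q) (\<sigma> q) (\<alpha> q) (\<tau> q) (\<beta> q) (i, j)" by (rule big)
    also have "\<dots> = f q l0"
      unfolding f_def l0_def lab_def joint_count_def prod.case
      by (intro arg_cong[where f = card]) auto
    finally show ?thesis .
  qed
  define g where "g u = (if u = s p then l0 else lab p u)" for u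
  have "card {u \<in> insert (s p) (S p). g u = l} \<le> card {u \<in> S q. lab q u = l}" for l
  proof -
    have "{u \<in> insert (s p) (S p). g u = l}
        = (if l = l0 then insert (s p) {u \<in> S p. lab p u = l} else {u \<in> S p. lab p u = l})"
      using s[of p] by (auto simp: g_def)
    then have "card {u \<in> insert (s p) (S p). g u = l} = (if l = l0 then Suc (f p l) else f p l)"
      using s[of p] fin[of p] by (simp add: f_def)
    also have "\<dots> \<le> f q l" using f_le[of l] f_less by auto
    finally show ?thesis by (simp add: f_def)
  qed
  then have "\<exists>\<pi>. inj_on \<pi> (insert (s p) (S p)) \<and> \<pi> ` insert (s p) (S p) \<subseteq> S q \<and>
      (\<forall>u\<in>insert (s p) (S p). lab q (\<pi> u) = g u)"
    using fin by (intro fibrewise_injection) simp_all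
  then obtain \<pi> where "inj_on \<pi> (insert (s p) (S p)) \<and> \<pi> ` insert (s p) (S p) \<subseteq> S q \<and>
      (\<forall>u\<in>insert (s p) (S p). lab q (\<pi> u) = g u)" ..
  then have \<pi>: "inj_on \<pi> (insert (s p) (S p))" "\<pi> ` insert (s p) (S p) \<subseteq> S q"
      "\<And>u. u \<in> insert (s p) (S p) \<Longrightarrow> lab q (\<pi> u) = g u"
    by blast+
  have \<sigma>S: "\<sigma> p ` S0 b \<subseteq> S p" and \<tau>S: "\<tau> p ` S0 b' \<subseteq> S p"
    using x(3)[of p] y(3)[of p] by (auto simp: injections_def)
  have "((b, \<sigma> p, (\<alpha> p)(s p := i)), (b', \<tau> p, (\<beta> p)(s p := j))) \<in> qo (insert (s p) (S p))"
  proof (rule qo_pullback[OF _ fin qo \<pi>(1,2)])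
    show "finite (insert (s p) (S p))" using fin by simp
    show "\<sigma> p \<in> injections (S0 b) (insert (s p) (S p))" "\<tau> p \<in> injections (S0 b') (insert (s p) (S p))"
      using x(3) y(3) by (simp_all add: injections_insert)
    show "(\<alpha> p)(s p := i) \<in> extensional (insert (s p) (S p) - \<sigma> p ` S0 b)"
      using x(5)[of p] \<sigma>S s[of p] by (auto simp: extensional_def)
    show "(\<beta> p)(s p := j) \<in> extensional (insert (s p) (S p) - \<tau> p ` S0 b')"
      using y(5)[of p] \<tau>S s[of p] by (auto simp: extensional_def)
    show "\<sigma> q e = \<pi> (\<sigma> p e)" if e: "e \<in> S0 b" for e
    proof -
      have "\<sigma> p e \<in> S p" "\<sigma> p e \<noteq> s p" using \<sigma>S s[of p] e by auto
      \<comment> \<open>Equal labels mean equal fibres, and e belongs to the right-hand one.\<close>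
      then have "{e'\<in>S0 b. \<sigma> q e' = \<pi> (\<sigma> p e)} = {e'\<in>S0 b. \<sigma> p e' = \<sigma> p e}"
        using \<pi>(3)[of "\<sigma> p e"] by (simp add: lab_def g_def)
      then show ?thesis using e by blast
    qed
    show "\<tau> q e = \<pi> (\<tau> p e)" if e: "e \<in> S0 b'" for e
    proof -
      have "\<tau> p e \<in> S p" "\<tau> p e \<noteq> s p" using \<tau>S s[of p] e by auto
      then have "{e'\<in>S0 b'. \<tau> q e' = \<pi> (\<tau> p e)} = {e'\<in>S0 b'. \<tau> p e' = \<tau> p e}"
        using \<pi>(3)[of "\<tau> p e"] by (simp add: lab_def g_def)
      then show ?thesis using e by blast
    qed
    show "\<alpha> q (\<pi> u) = ((\<alpha> p)(s p := i)) u" if "u \<in> insert (s p) (S p) - \<sigma> p ` S0 b" for u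
      using \<pi>(3)[of u] that by (auto simp: lab_def g_def l0_def split: if_splits)
    show "\<beta> q (\<pi> u) = ((\<beta> p)(s p := j)) u" if "u \<in> insert (s p) (S p) - \<tau> p ` S0 b'" for u
      using \<pi>(3)[of u] that by (auto simp: lab_def g_def l0_def split: if_splits)
  qed
  then show False using bad by blast
qed

end

section \<open>Joint colour counts\<close>

text \<open>Subtraction is truncated, so this undoes \<open>raise\<close> from one side only; the
  other side requires positive counts on U.\<close>

definition lower :: "nat set \<Rightarrow> (nat \<Rightarrow> nat) \<Rightarrow> nat \<Rightarrow> nat" where
  "lower U m = (\<lambda>i. if i \<in> U then m i - 1 else m i)"

lemma raise_empty [simp]: "raise {} m = m"
  by (simp add: raise_def)

lemma raise_insert: "i \<notin> U \<Longrightarrow> raise (insert i U) m = (raise U m)(i := Suc (raise U m i))"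
  by (auto simp: raise_def)

lemma lower_empty [simp]: "lower {} m = m"
  by (simp add: lower_def)

lemma lower_insert: "i \<notin> U \<Longrightarrow> lower (insert i U) m = (lower U m)(i := lower U m i - 1)"
  by (auto simp: lower_def)

lemma lower_raise [simp]: "lower U (raise U m) = m"
  by (auto simp: raise_def lower_def)

lemma raise_lower: "(\<And>i. i \<in> U \<Longrightarrow> 0 < m i) \<Longrightarrow> raise U (lower U m) = m"
  by (auto simp: raise_def lower_def fun_eq_iff)

lemma card_colour_count:
  assumes "finite S" "\<sigma> \<in> injections S0 S" "\<alpha> \<in> S - \<sigma> ` S0 \<rightarrow> I" "finite I"
  shows "card S = card S0 + sum (colour_count S0 S \<sigma> \<alpha>) I"
proof -
  have sub: "\<sigma> ` S0 \<subseteq> S" and inj: "inj_on \<sigma> S0" using assms(2) by (auto simp: injections_def)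
  have "S - \<sigma> ` S0 = (\<Union>j\<in>I. {u \<in> S - \<sigma> ` S0. \<alpha> u = j})"
    using assms(3) by auto
  then have "card (S - \<sigma> ` S0) = card (\<Union>j\<in>I. {u \<in> S - \<sigma> ` S0. \<alpha> u = j})" by (rule arg_cong)
  also have "\<dots> = sum (colour_count S0 S \<sigma> \<alpha>) I"
    unfolding colour_count_def using assms(1,4) by (intro card_UN_disjoint) auto
  finally have "card (S - \<sigma> ` S0) = sum (colour_count S0 S \<sigma> \<alpha>) I" .
  moreover have "card S = card (\<sigma> ` S0) + card (S - \<sigma> ` S0)"
    using sub assms(1) by (metis card_Diff_subset card_mono finite_subset le_add_diff_inverse)
  ultimately show ?thesis using inj by (simp add: card_image)
qed

text \<open>Points outside B are sorted by their second colour; at most \<open>card B\<close> points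
  are lost. In the application, B is the image of the second injection.\<close>

lemma card_le_joint_sum:
  assumes "finite A" "finite B" "finite J" "\<beta> \<in> A - B \<rightarrow> J"
  shows "card {u\<in>A. P u} \<le> (\<Sum>j\<in>J. card {u \<in> A - B. P u \<and> \<beta> u = j}) + card B"
proof -
  have "{u\<in>A. P u} \<subseteq> (\<Union>j\<in>J. {u \<in> A - B. P u \<and> \<beta> u = j}) \<union> B"
    using assms(4) by auto
  then have "card {u\<in>A. P u} \<le> card ((\<Union>j\<in>J. {u \<in> A - B. P u \<and> \<beta> u = j}) \<union> B)"
    using assms(1-3) by (intro card_mono) auto
  also have "\<dots> \<le> card (\<Union>j\<in>J. {u \<in> A - B. P u \<and> \<beta> u = j}) + card B" by (rule card_Un_le)
  also have "card (\<Union>j\<in>J. {u \<in> A - B. P u \<and> \<beta> u = j}) \<le> (\<Sum>j\<in>J. card {u \<in> A - B. P u \<and> \<beta> u = j})"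
    using assms(3) by (rule card_UN_le)
  finally show ?thesis by simp
qed

text \<open>Distinct sets of equal finite size each contain an element missing from the other, and
  each of these two would have to exceed the other.\<close>

lemma top_set_unique:
  fixes m :: "nat \<Rightarrow> nat"
  assumes "finite I" "V \<subseteq> I" "V' \<subseteq> I" "card V = card V'"
    and "\<And>i j. i \<in> V \<Longrightarrow> j \<in> I - V \<Longrightarrow> m j < m i" "\<And>i j. i \<in> V' \<Longrightarrow> j \<in> I - V' \<Longrightarrow> m j < m i"
  shows "V = V'"
proof (rule ccontr)
  assume "V \<noteq> V'"
  have "finite V" "finite V'" using assms(1-3) finite_subset by auto
  then have "\<not> V \<subseteq> V'" "\<not> V' \<subseteq> V"
    using \<open>V \<noteq> V'\<close> assms(4) card_subset_eq by metis+
  then obtain i j where "i \<in> V - V'" "j \<in> V' - V" by blast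
  then show False using assms(2,3) assms(5)[of i j] assms(6)[of j i] by force
qed

context infinite_compatible_quasi_orders
begin

abbreviation I :: "nat \<Rightarrow> nat set" where "I b \<equiv> {1..k b}"

text \<open>
  The pairs of quasi-ordered elements are recorded up to isomorphism by the colour counts of both
  components and by the number of common points of each pair of colours.
\<close>

definition joint :: "nat \<Rightarrow> nat \<Rightarrow> (nat \<Rightarrow> nat) \<Rightarrow> (nat \<Rightarrow> nat) \<Rightarrow> (nat \<times> nat \<Rightarrow> nat) \<Rightarrow> bool" where
  "joint b b' m m' v \<longleftrightarrow> (\<exists>S \<sigma> \<alpha> \<tau> \<beta>. finite S \<and> ((b, \<sigma>, \<alpha>), (b', \<tau>, \<beta>)) \<in> qo S \<and>
     m = colour_count (S0 b) S \<sigma> \<alpha> \<and> m' = colour_count (S0 b') S \<tau> \<beta> \<and>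
     v = joint_count (S0 b) (S0 b') S \<sigma> \<alpha> \<tau> \<beta>)"

text \<open>One constant bounding both the number of colours and the size of \<open>S0 b\<close>,
  for every index b.\<close>

definition K :: nat where "K = (\<Sum>b\<in>{1..a}. k b + card (S0 b))"

lemma K_ge:
  assumes "b \<in> {1..a}"
  shows "k b \<le> K" "card (S0 b) \<le> K"
proof -
  have "k b + card (S0 b) \<le> K"
    unfolding K_def using assms by (intro member_le_sum) auto
  then show "k b \<le> K" "card (S0 b) \<le> K" by simp_all
qed

lemma joint_index:
  assumes "joint b b' m m' v"
  shows "b \<in> {1..a}" "b' \<in> {1..a}"
proof -
  obtain S \<sigma> \<alpha> \<tau> \<beta> where S: "finite S" and qo: "((b, \<sigma>, \<alpha>), (b', \<tau>, \<beta>)) \<in> qo S"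
    using assms unfolding joint_def by blast
  show "b \<in> {1..a}" "b' \<in> {1..a}" by (rule objD(1)[OF S qo_obj(1)[OF S qo]] objD(1)[OF S qo_obj(2)[OF S qo]])+
qed

lemma colour_count_eq_0:
  assumes "finite S" "(b, \<sigma>, \<alpha>) \<in> obj S" "i \<notin> I b"
  shows "colour_count (S0 b) S \<sigma> \<alpha> i = 0"
proof -
  have "{u \<in> S - \<sigma> ` S0 b. \<alpha> u = i} = {}" using objD(4)[OF assms(1,2)] assms(3) by blast
  then show ?thesis unfolding colour_count_def by (simp only: card.empty)
qed

lemma joint_supp:
  assumes "joint b b' m m' v"
  shows "i \<notin> I b \<Longrightarrow> m i = 0" "i \<notin> I b' \<Longrightarrow> m' i = 0"
proof -
  obtain S \<sigma> \<alpha> \<tau> \<beta> where S: "finite S" and qo: "((b, \<sigma>, \<alpha>), (b', \<tau>, \<beta>)) \<in> qo S"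
    and m: "m = colour_count (S0 b) S \<sigma> \<alpha>" "m' = colour_count (S0 b') S \<tau> \<beta>"
    using assms unfolding joint_def by blast
  show "i \<notin> I b \<Longrightarrow> m i = 0" unfolding m by (rule colour_count_eq_0[OF S qo_obj(1)[OF S qo]])
  show "i \<notin> I b' \<Longrightarrow> m' i = 0" unfolding m by (rule colour_count_eq_0[OF S qo_obj(2)[OF S qo]])
qed

lemma obj_card:
  assumes "finite S" "(b, \<sigma>, \<alpha>) \<in> obj S"
  shows "card S = card (S0 b) + sum (colour_count (S0 b) S \<sigma> \<alpha>) (I b)"
  using objD(3,4)[OF assms] assms(1) by (intro card_colour_count) (auto simp: PiE_def)

lemma joint_card:
  assumes "joint b b' m m' v"
  shows "card (S0 b) + sum m (I b) = card (S0 b') + sum m' (I b')"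
  using assms obj_card qo_obj unfolding joint_def by metis

lemma joint_le:
  assumes "joint b b' m m' v"
  shows "v (i, j) \<le> m i" "v (i, j) \<le> m' j"
  using assms unfolding joint_def colour_count_def joint_count_def
  by (auto intro!: card_mono)

text \<open>The only points coloured i that v misses are those in the image of the second
  injection.\<close>

lemma joint_row:
  assumes "joint b b' m m' v"
  shows "m i \<le> (\<Sum>j\<in>I b'. v (i, j)) + K"
proof -
  obtain S \<sigma> \<alpha> \<tau> \<beta> where S: "finite S" and qo: "((b, \<sigma>, \<alpha>), (b', \<tau>, \<beta>)) \<in> qo S"
    and m: "m = colour_count (S0 b) S \<sigma> \<alpha>" and v: "v = joint_count (S0 b) (S0 b') S \<sigma> \<alpha> \<tau> \<beta>"
    using assms unfolding joint_def by blast
  note y = objD[OF S qo_obj(2)[OF S qo]]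
  have "m i \<le> (\<Sum>j\<in>I b'. v (i, j)) + card (\<tau> ` S0 b')"
    unfolding m v colour_count_def joint_count_def prod.case
    using S y(2,4) by (intro card_le_joint_sum) auto
  also have "card (\<tau> ` S0 b') \<le> card (S0 b')" using y(2) by (rule card_image_le)
  also have "card (S0 b') \<le> K" using y(1) by (rule K_ge)
  finally show ?thesis by simp
qed

text \<open>Within one index the quasi-order is the equivalence relation \<open>sim b\<close>, by
  compatibility (2), so the two elements may be exchanged and v transposed.\<close>

lemma joint_swap:
  assumes "joint b b m m' v"
  shows "joint b b m' m (\<lambda>(i, j). v (j, i))"
proof -
  obtain S \<sigma> \<alpha> \<tau> \<beta> where S: "finite S" and qo: "((b, \<sigma>, \<alpha>), (b, \<tau>, \<beta>)) \<in> qo S"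
    and m: "m = colour_count (S0 b) S \<sigma> \<alpha>" "m' = colour_count (S0 b) S \<tau> \<beta>"
    and v: "v = joint_count (S0 b) (S0 b) S \<sigma> \<alpha> \<tau> \<beta>"
    using assms unfolding joint_def by blast
  have b: "b \<in> {1..a}" using objD(1)[OF S qo_obj(1)[OF S qo]] .
  interpret mf: model_functor "S0 b" "k b" "E b" "sim b" using model[OF b] .
  have "((\<sigma>, \<alpha>), (\<tau>, \<beta>)) \<in> sim b S" using compat2[OF S b] qo by blast
  then have "((\<tau>, \<beta>), (\<sigma>, \<alpha>)) \<in> sim b S"
    using mf.equiv_sim[OF S] by (meson equivE symD)
  then have "((b, \<tau>, \<beta>), (b, \<sigma>, \<alpha>)) \<in> qo S" using compat2[OF S b] by blast
  moreover have "(\<lambda>(i, j). v (j, i)) = joint_count (S0 b) (S0 b) S \<tau> \<beta> \<sigma> \<alpha>"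
    unfolding v joint_count_def fun_eq_iff by (auto intro!: arg_cong[where f = card])
  ultimately show ?thesis using S m unfolding joint_def by blast
qed

lemma joint_col:
  assumes "joint b b m m' v"
  shows "m' j \<le> (\<Sum>i\<in>I b. v (i, j)) + K"
  using joint_row[OF joint_swap[OF assms], of j] by simp

text \<open>Axiom (3) applied to two common points. Hence the matrix v has at most one nonzero entry
  in each row and column: its support is a partial bijection of colours.\<close>

lemma joint_matching:
  assumes "joint b b m m' v" "0 < v (i, j)" "0 < v (i', j')"
  shows "i = i' \<longleftrightarrow> j = j'"
proof -
  obtain S \<sigma> \<alpha> \<tau> \<beta> where S: "finite S" and qo: "((b, \<sigma>, \<alpha>), (b, \<tau>, \<beta>)) \<in> qo S"
    and v: "v = joint_count (S0 b) (S0 b) S \<sigma> \<alpha> \<tau> \<beta>"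
    using assms(1) unfolding joint_def by blast
  have b: "b \<in> {1..a}" using objD(1)[OF S qo_obj(1)[OF S qo]] .
  interpret mf: model_functor "S0 b" "k b" "E b" "sim b" using model[OF b] .
  have sim: "((\<sigma>, \<alpha>), (\<tau>, \<beta>)) \<in> sim b S" using compat2[OF S b] qo by blast
  have ex: "\<exists>u. u \<in> S - (\<sigma> ` S0 b \<union> \<tau> ` S0 b) \<and> \<alpha> u = i \<and> \<beta> u = j" if "0 < v (i, j)" for i j
  proof -
    have "{u \<in> S - \<sigma> ` S0 b - \<tau> ` S0 b. \<alpha> u = i \<and> \<beta> u = j} \<noteq> {}"
      using that unfolding v joint_count_def prod.case by (metis card.empty less_irrefl)
    then show ?thesis by blast
  qed
  obtain u where u: "u \<in> S - (\<sigma> ` S0 b \<union> \<tau> ` S0 b)" "\<alpha> u = i" "\<beta> u = j"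
    using ex[OF assms(2)] by blast
  obtain u' where u': "u' \<in> S - (\<sigma> ` S0 b \<union> \<tau> ` S0 b)" "\<alpha> u' = i'" "\<beta> u' = j'"
    using ex[OF assms(3)] by blast
  show ?thesis using mf.axiom3[OF S sim u(1) u'(1)] u u' by simp
qed

definition joint_threshold :: "nat \<Rightarrow> bool" where
  "joint_threshold C \<longleftrightarrow> (\<forall>b b' m m' v i j. joint b b' m m' v \<longrightarrow> C \<le> v (i, j) \<longrightarrow>
    joint b b' (m(i := Suc (m i))) (m'(j := Suc (m' j))) (v((i, j) := Suc (v (i, j)))))"

lemma joint_up:
  assumes "joint_threshold C" "joint b b' m m' v" "C \<le> v (i, j)"
  shows "joint b b' (m(i := Suc (m i))) (m'(j := Suc (m' j))) (v((i, j) := Suc (v (i, j))))"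
  using assms unfolding joint_threshold_def by simp

lemma joint_threshold_exists: "\<exists>C. joint_threshold C"
proof -
  have "\<forall>b b' i j. \<exists>C. \<forall>S \<sigma> \<alpha> \<tau> \<beta> s. finite S \<and> ((b, \<sigma>, \<alpha>), (b', \<tau>, \<beta>)) \<in> qo S \<and> s \<notin> S \<and>
     C \<le> joint_count (S0 b) (S0 b') S \<sigma> \<alpha> \<tau> \<beta> (i, j) \<longrightarrow>
     ((b, \<sigma>, \<alpha>(s := i)), (b', \<tau>, \<beta>(s := j))) \<in> qo (insert s S)"
    by (intro allI qo_insert)
  then have "\<exists>C. \<forall>b b' i j. \<forall>S \<sigma> \<alpha> \<tau> \<beta> s. finite S \<and> ((b, \<sigma>, \<alpha>), (b', \<tau>, \<beta>)) \<in> qo S \<and> s \<notin> S \<and>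
     C b b' i j \<le> joint_count (S0 b) (S0 b') S \<sigma> \<alpha> \<tau> \<beta> (i, j) \<longrightarrow>
     ((b, \<sigma>, \<alpha>(s := i)), (b', \<tau>, \<beta>(s := j))) \<in> qo (insert s S)"
    by (simp only: choice_iff)
  then obtain C0 where "\<forall>b b' i j. \<forall>S \<sigma> \<alpha> \<tau> \<beta> s. finite S \<and> ((b, \<sigma>, \<alpha>), (b', \<tau>, \<beta>)) \<in> qo S \<and> s \<notin> S \<and>
     C0 b b' i j \<le> joint_count (S0 b) (S0 b') S \<sigma> \<alpha> \<tau> \<beta> (i, j) \<longrightarrow>
     ((b, \<sigma>, \<alpha>(s := i)), (b', \<tau>, \<beta>(s := j))) \<in> qo (insert s S)" ..
  then have C0: "\<And>b b' i j S \<sigma> \<alpha> \<tau> \<beta> s. finite S \<Longrightarrow>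
     ((b, \<sigma>, \<alpha>), (b', \<tau>, \<beta>)) \<in> qo S \<Longrightarrow> s \<notin> S \<Longrightarrow>
     C0 b b' i j \<le> joint_count (S0 b) (S0 b') S \<sigma> \<alpha> \<tau> \<beta> (i, j) \<Longrightarrow>
     ((b, \<sigma>, \<alpha>(s := i)), (b', \<tau>, \<beta>(s := j))) \<in> qo (insert s S)"
    by simp
  define Z where "Z = {1..a} \<times> {1..a} \<times> {..K} \<times> {..K}"
  \<comment> \<open>The sum dominates each single threshold. The successor makes v (i, j) positive,
    which forces i and j to be actual colours and so places the quadruple in the finite set
    \<open>Z\<close>.\<close>
  define C where "C = Suc (\<Sum>(b, b', i, j)\<in>Z. C0 b b' i j)"
  have "joint b b' (m(i := Suc (m i))) (m'(j := Suc (m' j))) (v((i, j) := Suc (v (i, j))))"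
    if J: "joint b b' m m' v" and Cv: "C \<le> v (i, j)" for b b' m m' v i j
  proof -
    obtain S \<sigma> \<alpha> \<tau> \<beta> where S: "finite S" and qo: "((b, \<sigma>, \<alpha>), (b', \<tau>, \<beta>)) \<in> qo S"
      and m: "m = colour_count (S0 b) S \<sigma> \<alpha>" "m' = colour_count (S0 b') S \<tau> \<beta>"
      and v: "v = joint_count (S0 b) (S0 b') S \<sigma> \<alpha> \<tau> \<beta>"
      using J unfolding joint_def by blast
    have "0 < m i" "0 < m' j" using joint_le[OF J, of i j] Cv unfolding C_def by linarith+
    then have "i \<in> I b" "j \<in> I b'" using joint_supp[OF J] by (metis less_irrefl)+
    then have z: "(b, b', i, j) \<in> Z"
      using joint_index[OF J] K_ge(1)[of b] K_ge(1)[of b'] unfolding Z_def by auto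
    have "C0 b b' i j \<le> (\<Sum>(b, b', i, j)\<in>Z. C0 b b' i j)"
      using member_le_sum[OF z, of "\<lambda>(b, b', i, j). C0 b b' i j"] by (simp add: Z_def)
    then have le: "C0 b b' i j \<le> joint_count (S0 b) (S0 b') S \<sigma> \<alpha> \<tau> \<beta> (i, j)"
      using Cv unfolding C_def v by linarith
    obtain s where s: "s \<notin> S" using ex_new_if_finite[OF infinite_univ S] by blast
    note x = objD[OF S qo_obj(1)[OF S qo]] and y = objD[OF S qo_obj(2)[OF S qo]]
    show ?thesis
      unfolding joint_def m v
        colour_count_insert[OF S s x(3), symmetric] colour_count_insert[OF S s y(3), symmetric]
        joint_count_insert[OF S s x(3) y(3), symmetric]
      using C0[OF S qo s le] S by blast
  qed
  then have "joint_threshold C" unfolding joint_threshold_def by simp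
  then show ?thesis ..
qed

text \<open>Delete one common point coloured (i, j), by pulling back along the inclusion of its
  complement. The colourings are reset to \<open>undefined\<close> there to stay
  extensional.\<close>

lemma joint_down:
  assumes "joint b b' m m' v" "0 < v (i, j)"
  shows "joint b b' (m(i := m i - 1)) (m'(j := m' j - 1)) (v((i, j) := v (i, j) - 1))"
proof -
  obtain S \<sigma> \<alpha> \<tau> \<beta> where S: "finite S" and qo: "((b, \<sigma>, \<alpha>), (b', \<tau>, \<beta>)) \<in> qo S"
    and m: "m = colour_count (S0 b) S \<sigma> \<alpha>" "m' = colour_count (S0 b') S \<tau> \<beta>"
    and v: "v = joint_count (S0 b) (S0 b') S \<sigma> \<alpha> \<tau> \<beta>"
    using assms unfolding joint_def by blast
  note x = objD[OF S qo_obj(1)[OF S qo]] and y = objD[OF S qo_obj(2)[OF S qo]]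
  have "{u \<in> S - \<sigma> ` S0 b - \<tau> ` S0 b'. \<alpha> u = i \<and> \<beta> u = j} \<noteq> {}"
    using assms(2) unfolding v joint_count_def prod.case by (metis card.empty less_irrefl)
  then obtain u where u: "u \<in> S" "u \<notin> \<sigma> ` S0 b" "u \<notin> \<tau> ` S0 b'" "\<alpha> u = i" "\<beta> u = j" by blast
  let ?S = "S - {u}" and ?\<alpha> = "\<alpha>(u := undefined)" and ?\<beta> = "\<beta>(u := undefined)"
  have ins: "insert u ?S = S" "u \<notin> ?S" using u(1) by auto
  have fin: "finite ?S" using S by simp
  have eq: "?\<alpha>(u := i) = \<alpha>" "?\<beta>(u := j) = \<beta>" using u by auto
  have inj: "\<sigma> \<in> injections (S0 b) ?S" "\<tau> \<in> injections (S0 b') ?S"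
    using x(3) y(3) u(2,3) by (auto simp: injections_def)
  have "((b, \<sigma>, ?\<alpha>), (b', \<tau>, ?\<beta>)) \<in> qo ?S"
    using x(5) y(5) inj by (intro qo_pullback[OF fin S qo, of id]) (auto simp: extensional_def)
  moreover have "m = (colour_count (S0 b) ?S \<sigma> ?\<alpha>)(i := Suc (colour_count (S0 b) ?S \<sigma> ?\<alpha> i))"
    using colour_count_insert[OF fin ins(2) inj(1), of ?\<alpha> i] unfolding ins eq m .
  then have "m(i := m i - 1) = colour_count (S0 b) ?S \<sigma> ?\<alpha>" by auto
  moreover have "m' = (colour_count (S0 b') ?S \<tau> ?\<beta>)(j := Suc (colour_count (S0 b') ?S \<tau> ?\<beta> j))"
    using colour_count_insert[OF fin ins(2) inj(2), of ?\<beta> j] unfolding ins eq m .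
  then have "m'(j := m' j - 1) = colour_count (S0 b') ?S \<tau> ?\<beta>" by auto
  moreover have "v = (joint_count (S0 b) (S0 b') ?S \<sigma> ?\<alpha> \<tau> ?\<beta>)
      ((i, j) := Suc (joint_count (S0 b) (S0 b') ?S \<sigma> ?\<alpha> \<tau> ?\<beta> (i, j)))"
    using joint_count_insert[OF fin ins(2) inj, of ?\<alpha> i ?\<beta> j] unfolding ins eq v .
  then have "v((i, j) := v (i, j) - 1) = joint_count (S0 b) (S0 b') ?S \<sigma> ?\<alpha> \<tau> ?\<beta>" by auto
  ultimately show ?thesis using fin unfolding joint_def by blast
qed

end

section \<open>Stability of the weights\<close>

context infinite_compatible_quasi_orders
begin

definition rel :: "nat \<Rightarrow> nat \<Rightarrow> (nat \<Rightarrow> nat) \<Rightarrow> (nat \<Rightarrow> nat) \<Rightarrow> bool" where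
  "rel b b' m m' \<longleftrightarrow> (\<exists>v. joint b b' m m' v)"

definition extends :: "nat \<Rightarrow> nat \<Rightarrow> (nat \<Rightarrow> nat) \<Rightarrow> bool" where
  "extends b b' m \<longleftrightarrow> (\<exists>m'. rel b b' m m')"

text \<open>By reflexivity, \<open>extends b b m\<close> says that m occurs as a vector of colour
  counts. Only b' > b is tested because comparable elements of equal index are equivalent.\<close>

definition weight :: "nat \<Rightarrow> (nat \<Rightarrow> nat) \<Rightarrow> real" where
  "weight b m = (if extends b b m \<and> \<not> (\<exists>b'>b. extends b b' m)
     then 1 / real (card {m'. rel b b m m'}) else 0)"

text \<open>Pigeonhole: a row has at most K entries and misses at most K of the m i points.\<close>

lemma joint_row_large:
  assumes "joint b b' m m' v" "K + K * C < m i"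
  shows "\<exists>j\<in>I b'. C < v (i, j)"
proof (rule ccontr)
  assume "\<not> ?thesis"
  then have "(\<Sum>j\<in>I b'. v (i, j)) \<le> card (I b') * C"
    by (intro sum_bounded_above[where K = C, simplified]) (auto simp: not_less)
  also have "\<dots> \<le> K * C" using K_ge(1)[OF joint_index(2)[OF assms(1)]] by simp
  finally show False using joint_row[OF assms(1), of i] assms(2) by simp
qed

text \<open>A frequent colour i is paired with some colour j more than C times, so a common point
  coloured (i, j) can be added to a witness or removed from it.\<close>

lemma extends_stable:
  "\<exists>C. \<forall>b b' m i. C \<le> m i \<longrightarrow> extends b b' (m(i := Suc (m i))) = extends b b' m"
proof -
  obtain C where C: "joint_threshold C" using joint_threshold_exists ..
  have "extends b b' (m(i := Suc (m i))) \<longleftrightarrow> extends b b' m"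
    if m: "Suc (K + K * C) \<le> m i" for b b' m and i :: nat
  proof
    assume "extends b b' m"
    then obtain m' v where J: "joint b b' m m' v" unfolding extends_def rel_def by blast
    then obtain j where "C < v (i, j)" using joint_row_large[OF J, of C i] m by auto
    then show "extends b b' (m(i := Suc (m i)))"
      using joint_up[OF C J, of i j] unfolding extends_def rel_def by auto
  next
    assume "extends b b' (m(i := Suc (m i)))"
    then obtain m' v where J: "joint b b' (m(i := Suc (m i))) m' v"
      unfolding extends_def rel_def by blast
    then obtain j where "C < v (i, j)" using joint_row_large[OF J, of C i] m by auto
    then show "extends b b' m"
      using joint_down[OF J, of i j] unfolding extends_def rel_def by auto
  qed
  then show ?thesis by (intro exI[of _ "Suc (K + K * C)"]) simp
qed

lemma extends_raise:
  assumes stable: "\<And>m i. C \<le> m i \<Longrightarrow> extends b b' (m(i := Suc (m i))) \<longleftrightarrow> extends b b' m"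
    and "finite U" "\<And>i. i \<in> U \<Longrightarrow> C \<le> m i"
  shows "extends b b' (raise U m) \<longleftrightarrow> extends b b' m"
  using assms(2,3)
proof (induction U)
  case (insert i U)
  have "C \<le> raise U m i" using insert by (simp add: raise_def)
  then show ?case
    unfolding raise_insert[OF insert.hyps(2)] using stable[of "raise U m" i] insert by blast
qed simp

text \<open>Points coloured (i, \<mu> i) are added one by one. Injectivity of \<mu> ensures that no
  second colour is raised twice; v only grows, so the remaining entries stay above the
  threshold.\<close>

lemma joint_raise:
  assumes C: "joint_threshold C"
    and J: "joint b b' m m' v" and "finite U" "inj_on \<mu> U" "\<And>i. i \<in> U \<Longrightarrow> C \<le> v (i, \<mu> i)"
  shows "\<exists>v'. joint b b' (raise U m) (raise (\<mu> ` U) m') v' \<and> (\<forall>p. v p \<le> v' p)"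
  using assms(3-)
proof (induction U)
  case empty
  then show ?case using J by auto
next
  case (insert i U)
  then obtain v' where v': "joint b b' (raise U m) (raise (\<mu> ` U) m') v'" "\<And>p. v p \<le> v' p"
    by auto
  have "C \<le> v' (i, \<mu> i)" using insert.prems(2)[of i] v'(2)[of "(i, \<mu> i)"] by simp
  note J' = joint_up[OF C v'(1) this]
  have "\<mu> i \<notin> \<mu> ` U" using insert by auto
  then have "joint b b' (raise (insert i U) m) (raise (\<mu> ` insert i U) m')
      (v'((i, \<mu> i) := Suc (v' (i, \<mu> i))))"
    using J' insert.hyps by (simp add: raise_insert)
  moreover have "v p \<le> (v'((i, \<mu> i) := Suc (v' (i, \<mu> i)))) p" for p
    using v'(2)[of p] by auto
  ultimately show ?case by blast
qed

text \<open>Rows outside U are left untouched, which keeps the entries still to be lowered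
  positive.\<close>

lemma joint_lower:
  assumes J: "joint b b' m m' v" and "finite U" "inj_on \<mu> U" "\<And>i. i \<in> U \<Longrightarrow> 0 < v (i, \<mu> i)"
  shows "\<exists>v'. joint b b' (lower U m) (lower (\<mu> ` U) m') v' \<and> (\<forall>i j. i \<notin> U \<longrightarrow> v' (i, j) = v (i, j))"
  using assms(2-)
proof (induction U)
  case empty
  then show ?case using J by auto
next
  case (insert i U)
  then obtain v' where v': "joint b b' (lower U m) (lower (\<mu> ` U) m') v'"
      "\<And>i j. i \<notin> U \<Longrightarrow> v' (i, j) = v (i, j)"
    by auto
  have "0 < v' (i, \<mu> i)" using insert.prems(2)[of i] v'(2) insert.hyps by simp
  note J' = joint_down[OF v'(1) this]
  have "\<mu> i \<notin> \<mu> ` U" using insert by auto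
  then have "joint b b' (lower (insert i U) m) (lower (\<mu> ` insert i U) m')
      (v'((i, \<mu> i) := v' (i, \<mu> i) - 1))"
    using J' insert.hyps by (simp add: lower_insert)
  then show ?case using v'(2) by (intro exI conjI) auto
qed

text \<open>\<mu> i is the colour matched with i. Row i has a single nonzero entry, so m i \<le> m'
  (\<mu> i) + K; similarly a column count is known up to K. Thus a gap T shrinks by at most 2 * K. A
  remaining gap of 2 leaves strict domination even after lowering the dominating colours by
  one.\<close>

lemma joint_separated:
  assumes J: "joint b b m m' v" and U: "U \<subseteq> I b"
    and T: "K + K * C < T" "2 * K + 2 \<le> T"
    and sep: "\<And>i. i \<in> U \<Longrightarrow> T \<le> m i" "\<And>i j. i \<in> U \<Longrightarrow> j \<in> I b - U \<Longrightarrow> m j + T \<le> m i"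
  shows "\<exists>\<mu>. inj_on \<mu> U \<and> \<mu> ` U \<subseteq> I b \<and> (\<forall>i\<in>U. C < v (i, \<mu> i)) \<and>
    (\<forall>i\<in>\<mu> ` U. \<forall>j\<in>I b - \<mu> ` U. m' j + 2 \<le> m' i)"
proof -
  have "\<forall>i\<in>U. \<exists>j. j \<in> I b \<and> C < v (i, j)"
    using joint_row_large[OF J] T(1) sep(1) by (metis order.strict_trans2)
  then have "\<exists>\<mu>. \<forall>i\<in>U. \<mu> i \<in> I b \<and> C < v (i, \<mu> i)" by (rule bchoice)
  then obtain \<mu> where \<mu>: "\<And>i. i \<in> U \<Longrightarrow> \<mu> i \<in> I b" "\<And>i. i \<in> U \<Longrightarrow> C < v (i, \<mu> i)" by blast
  have pos: "0 < v (i, \<mu> i)" if "i \<in> U" for i using \<mu>(2)[OF that] by simp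
  have inj: "inj_on \<mu> U"
    using joint_matching[OF J pos pos] by (auto simp: inj_on_def)
  have "m' j + 2 \<le> m' (\<mu> i)" if i: "i \<in> U" and j: "j \<in> I b - \<mu> ` U" for i j
  proof -
    have "(\<Sum>j\<in>I b. v (i, j)) = (\<Sum>j\<in>{\<mu> i}. v (i, j))"
      using joint_matching[OF J pos[OF i]] \<mu>(1)[OF i]
      by (intro sum.mono_neutral_right) auto
    then have "m i \<le> v (i, \<mu> i) + K" using joint_row[OF J, of i] by simp
    then have lower: "m i \<le> m' (\<mu> i) + K" using joint_le(2)[OF J, of i "\<mu> i"] by simp
    have zero: "v (i', j) = 0" if "i' \<in> U" for i'
      using joint_matching[OF J pos[OF that], of i' j] j that by auto
    \<comment> \<open>Column j has at most one nonzero entry, and its row lies outside U because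
      colours in U are matched only with colours in the image of \<mu>.\<close>
    have "(\<Sum>i'\<in>I b. v (i', j)) + T \<le> m i"
    proof (cases "\<exists>i'\<in>I b. 0 < v (i', j)")
      case True
      then obtain i' where i': "i' \<in> I b" "0 < v (i', j)" by blast
      have "(\<Sum>i'\<in>I b. v (i', j)) = (\<Sum>i'\<in>{i'}. v (i', j))"
        using joint_matching[OF J i'(2)] i'(1) by (intro sum.mono_neutral_right) auto
      then have "(\<Sum>i'\<in>I b. v (i', j)) \<le> m i'" using joint_le(1)[OF J, of i' j] by simp
      moreover have "i' \<notin> U" using zero i'(2) by auto
      ultimately show ?thesis using sep(2)[OF i, of i'] i'(1) by simp
    next
      case False
      then show ?thesis using sep(1)[OF i] by simp
    qed
    then show ?thesis using joint_col[OF J, of j] lower T(2) by simp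
  qed
  then show ?thesis using inj \<mu> by (intro exI[of _ \<mu>]) auto
qed

lemma finite_rel:
  "finite {m'. rel b b m m'}"
proof (rule finite_subset)
  show "{m'. rel b b m m'} \<subseteq> comps (I b) 0 (sum m (I b))"
    using joint_card joint_supp(2) by (fastforce simp: rel_def comps_def)
  show "finite (comps (I b) 0 (sum m (I b)))" by (intro finite_comps) simp
qed

text \<open>
  The bijection between the classes shifts each class member along its own set of dominating colours,
  which is determined by the member and the cardinality of \<open>U\<close> because of the gap.
\<close>

lemma card_rel_raise:
  assumes C: "joint_threshold C"
    and U: "U \<subseteq> I b" and T: "K + K * C < T" "2 * K + 2 \<le> T"
    and sep: "\<And>i. i \<in> U \<Longrightarrow> T \<le> m i" "\<And>i j. i \<in> U \<Longrightarrow> j \<in> I b - U \<Longrightarrow> m j + T \<le> m i"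
  shows "card {m'. rel b b (raise U m) m'} = card {m'. rel b b m m'}"
proof (rule antisym)
  have finU: "finite U" using U finite_subset by blast
  have top: "V = V'"
    if "V \<subseteq> I b" "V' \<subseteq> I b" "card V = card U" "card V' = card U"
      "\<forall>i\<in>V. \<forall>j\<in>I b - V. x j < x i" "\<forall>i\<in>V'. \<forall>j\<in>I b - V'. x j < x i"
    for V V' and x :: "nat \<Rightarrow> nat"
    using that by (intro top_set_unique[of "I b" V V' x]) auto
  have "\<forall>m'\<in>{m'. rel b b m m'}. \<exists>V. V \<subseteq> I b \<and> card V = card U \<and>
      (\<forall>i\<in>V. \<forall>j\<in>I b - V. m' j + 2 \<le> m' i) \<and> rel b b (raise U m) (raise V m')"
  proof
    fix m' assume "m' \<in> {m'. rel b b m m'}"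
    then obtain v where J: "joint b b m m' v" unfolding rel_def by blast
    obtain \<mu> where \<mu>: "inj_on \<mu> U" "\<mu> ` U \<subseteq> I b" "\<forall>i\<in>U. C < v (i, \<mu> i)"
        "\<forall>i\<in>\<mu> ` U. \<forall>j\<in>I b - \<mu> ` U. m' j + 2 \<le> m' i"
      using joint_separated[OF J U T sep] by blast
    have "rel b b (raise U m) (raise (\<mu> ` U) m')"
      using joint_raise[OF C J finU \<mu>(1)] \<mu>(3) unfolding rel_def by fastforce
    then show "\<exists>V. V \<subseteq> I b \<and> card V = card U \<and>
        (\<forall>i\<in>V. \<forall>j\<in>I b - V. m' j + 2 \<le> m' i) \<and> rel b b (raise U m) (raise V m')"
      using \<mu> by (intro exI[of _ "\<mu> ` U"]) (simp add: card_image)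
  qed
  then have "\<exists>V. \<forall>m'\<in>{m'. rel b b m m'}. V m' \<subseteq> I b \<and> card (V m') = card U \<and>
      (\<forall>i\<in>V m'. \<forall>j\<in>I b - V m'. m' j + 2 \<le> m' i) \<and> rel b b (raise U m) (raise (V m') m')"
    by (rule bchoice)
  then obtain V where V: "\<forall>m'\<in>{m'. rel b b m m'}. V m' \<subseteq> I b \<and> card (V m') = card U \<and>
      (\<forall>i\<in>V m'. \<forall>j\<in>I b - V m'. m' j + 2 \<le> m' i) \<and> rel b b (raise U m) (raise (V m') m')" ..
  have V': "V x \<subseteq> I b" "card (V x) = card U" "rel b b (raise U m) (raise (V x) x)"
      "\<And>i j. i \<in> V x \<Longrightarrow> j \<in> I b - V x \<Longrightarrow> x j + 2 \<le> x i" if "rel b b m x" for x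
    using bspec[OF V, of x] that by simp_all
  show "card {m'. rel b b m m'} \<le> card {m'. rel b b (raise U m) m'}"
  proof (rule card_inj_on_le[where f = "\<lambda>m'. raise (V m') m'"])
    show "(\<lambda>m'. raise (V m') m') ` {m'. rel b b m m'} \<subseteq> {m'. rel b b (raise U m) m'}"
      using V'(3) by (intro image_subsetI) simp
    show "inj_on (\<lambda>m'. raise (V m') m') {m'. rel b b m m'}"
    proof (rule inj_onI)
      fix x y assume x: "x \<in> {m'. rel b b m m'}" and y: "y \<in> {m'. rel b b m m'}"
        and eq: "raise (V x) x = raise (V y) y"
      have gap: "\<forall>i\<in>V z. \<forall>j\<in>I b - V z. raise (V z) z j < raise (V z) z i"
        if "z \<in> {m'. rel b b m m'}" for z
        
      proof (intro ballI)
        fix i j assume "i \<in> V z" "j \<in> I b - V z"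
        then show "raise (V z) z j < raise (V z) z i"
          using V'(4)[of z i j] that by (simp add: raise_def)
      qed
      \<comment> \<open>Both sets have size \<open>card U\<close> and strictly dominate the same
        vector, the common image of x and y.\<close>
      have "V x = V y"
      proof (rule top)
        show "\<forall>i\<in>V x. \<forall>j\<in>I b - V x. raise (V x) x j < raise (V x) x i" using gap x .
        show "\<forall>i\<in>V y. \<forall>j\<in>I b - V y. raise (V x) x j < raise (V x) x i"
          unfolding eq using gap y .
      qed (use V'(1,2) x y in auto)
      then show "x = y" using eq raise_inj by (simp add: inj_eq)
    qed
    show "finite {m'. rel b b (raise U m) m'}" by (rule finite_rel)
  qed
  have sep': "T \<le> raise U m i" if "i \<in> U" for i
    using sep(1)[OF that] by (simp add: raise_def)
  have sep'': "raise U m j + T \<le> raise U m i" if "i \<in> U" "j \<in> I b - U" for i j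
    using sep(2)[OF that] that by (simp add: raise_def)
  have "\<forall>m'\<in>{m'. rel b b (raise U m) m'}. \<exists>V. V \<subseteq> I b \<and> card V = card U \<and>
      (\<forall>i\<in>V. \<forall>j\<in>I b - V. m' j + 2 \<le> m' i) \<and> (\<forall>i\<in>V. 0 < m' i) \<and> rel b b m (lower V m')"
  proof
    fix m' assume "m' \<in> {m'. rel b b (raise U m) m'}"
    then obtain v where J: "joint b b (raise U m) m' v" unfolding rel_def by blast
    obtain \<mu> where \<mu>: "inj_on \<mu> U" "\<mu> ` U \<subseteq> I b" "\<forall>i\<in>U. C < v (i, \<mu> i)"
        "\<forall>i\<in>\<mu> ` U. \<forall>j\<in>I b - \<mu> ` U. m' j + 2 \<le> m' i"
      using joint_separated[OF J U T sep' sep''] by blast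
    have "rel b b m (lower (\<mu> ` U) m')"
      using joint_lower[OF J finU \<mu>(1)] \<mu>(3) unfolding rel_def by fastforce
    moreover have "0 < m' (\<mu> i)" if "i \<in> U" for i
      using \<mu>(3) that joint_le(2)[OF J, of i "\<mu> i"] by force
    ultimately show "\<exists>V. V \<subseteq> I b \<and> card V = card U \<and> (\<forall>i\<in>V. \<forall>j\<in>I b - V. m' j + 2 \<le> m' i) \<and>
        (\<forall>i\<in>V. 0 < m' i) \<and> rel b b m (lower V m')"
      using \<mu> by (intro exI[of _ "\<mu> ` U"]) (simp add: card_image)
  qed
  then have "\<exists>V. \<forall>m'\<in>{m'. rel b b (raise U m) m'}. V m' \<subseteq> I b \<and> card (V m') = card U \<and>
      (\<forall>i\<in>V m'. \<forall>j\<in>I b - V m'. m' j + 2 \<le> m' i) \<and> (\<forall>i\<in>V m'. 0 < m' i) \<and> rel b b m (lower (V m') m')"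
    by (rule bchoice)
  then obtain V where V: "\<forall>m'\<in>{m'. rel b b (raise U m) m'}. V m' \<subseteq> I b \<and> card (V m') = card U \<and>
      (\<forall>i\<in>V m'. \<forall>j\<in>I b - V m'. m' j + 2 \<le> m' i) \<and> (\<forall>i\<in>V m'. 0 < m' i) \<and> rel b b m (lower (V m') m')" ..
  have V': "V x \<subseteq> I b" "card (V x) = card U" "rel b b m (lower (V x) x)"
      "\<And>i j. i \<in> V x \<Longrightarrow> j \<in> I b - V x \<Longrightarrow> x j + 2 \<le> x i"
      "\<And>i. i \<in> V x \<Longrightarrow> 0 < x i" if "rel b b (raise U m) x" for x
    using bspec[OF V, of x] that by simp_all
  show "card {m'. rel b b (raise U m) m'} \<le> card {m'. rel b b m m'}"
  proof (rule card_inj_on_le[where f = "\<lambda>m'. lower (V m') m'"])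
    show "(\<lambda>m'. lower (V m') m') ` {m'. rel b b (raise U m) m'} \<subseteq> {m'. rel b b m m'}"
      using V'(3) by (intro image_subsetI) simp
    show "inj_on (\<lambda>m'. lower (V m') m') {m'. rel b b (raise U m) m'}"
    proof (rule inj_onI)
      fix x y assume x: "x \<in> {m'. rel b b (raise U m) m'}" and y: "y \<in> {m'. rel b b (raise U m) m'}"
        and eq: "lower (V x) x = lower (V y) y"
      have gap: "\<forall>i\<in>V z. \<forall>j\<in>I b - V z. lower (V z) z j < lower (V z) z i"
        if "z \<in> {m'. rel b b (raise U m) m'}" for z
        
      proof (intro ballI)
        fix i j assume "i \<in> V z" "j \<in> I b - V z"
        then show "lower (V z) z j < lower (V z) z i"
          using V'(4)[of z i j] that by (simp add: lower_def)
      qed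
      have "V x = V y"
      proof (rule top)
        show "\<forall>i\<in>V x. \<forall>j\<in>I b - V x. lower (V x) x j < lower (V x) x i" using gap x .
        show "\<forall>i\<in>V y. \<forall>j\<in>I b - V y. lower (V x) x j < lower (V x) x i"
          unfolding eq using gap y .
      qed (use V'(1,2) x y in auto)
      \<comment> \<open>Positivity on the dominating set makes the truncated subtraction
        reversible.\<close>
      have "x = raise (V x) (lower (V x) x)"
        using V'(5) x by (intro raise_lower[symmetric]) simp
      also have "\<dots> = raise (V y) (lower (V y) y)"
        by (rule arg_cong2[OF \<open>V x = V y\<close> eq])
      also have "\<dots> = y"
        using V'(5) y by (intro raise_lower) simp
      finally show "x = y" .
    qed
    show "finite {m'. rel b b m m'}" by (rule finite_rel)
  qed
qed

text \<open>A large multiplicity of U makes every colour in U frequent and separates it from all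
  other colours, so both extendability and class size are unaffected.\<close>

lemma weight_stable:
  "\<exists>C. 0 < C \<and> (\<forall>b m U. U \<subseteq> I b \<longrightarrow> U \<noteq> {} \<longrightarrow> C \<le> lev (I b) U m \<longrightarrow>
     weight b (raise U m) = weight b m)"
proof -
  obtain C1 where C1: "joint_threshold C1" using joint_threshold_exists ..
  obtain C2 where C2: "\<forall>b b' m i. C2 \<le> m i \<longrightarrow> extends b b' (m(i := Suc (m i))) = extends b b' m"
    using extends_stable ..
  \<comment> \<open>The summands provide, in turn, matrix entries above \<open>C1\<close>, a gap of
    2 after the loss of 2 * K, and the bound for \<open>extends\<close>.\<close>
  define T where "T = Suc (K + K * C1) + (2 * K + 2) + C2"
  have "weight b (raise U m) = weight b m"
    if U: "U \<subseteq> I b" "U \<noteq> {}" and lev: "T \<le> lev (I b) U m" for b m U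
  proof -
    have sep1: "T \<le> m i" if "i \<in> U" for i
      using lev_le[OF that, of "I b" m] lev by simp
    have sep2: "m j + T \<le> m i" if "i \<in> U" "j \<in> I b - U" for i j
      using lev_le_diff[OF _ that, of m] lev by (simp add: T_def)
    have "extends b b' (raise U m) \<longleftrightarrow> extends b b' m" for b'
    proof (rule extends_raise[OF C2[rule_format]])
      show "finite U" using U(1) finite_subset by blast
      show "C2 \<le> m i" if "i \<in> U" for i using sep1[OF that] by (simp add: T_def)
    qed
    moreover have "card {m'. rel b b (raise U m) m'} = card {m'. rel b b m m'}"
      by (rule card_rel_raise[OF C1 U(1) _ _ sep1 sep2]) (simp_all add: T_def)
    ultimately show ?thesis unfolding weight_def by (simp only:)
  qed
  moreover have "0 < T" by (simp add: T_def)
  ultimately show ?thesis by (intro exI[of _ T]) simp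
qed

lemma weight_sum_ev_quasipoly:
  "ev_quasipoly (\<lambda>n. \<Sum>b\<in>{1..a}. \<Sum>m\<in>comps (I b) (card (S0 b)) n. weight b m)"
proof -
  obtain C where C: "0 < C \<and> (\<forall>b m U. U \<subseteq> I b \<longrightarrow> U \<noteq> {} \<longrightarrow> C \<le> lev (I b) U m \<longrightarrow>
     weight b (raise U m) = weight b m)"
    using weight_stable ..
  show ?thesis
  proof (intro ev_quasipoly_sum ev_quasipoly_stable_sum)
    show "0 < C" using C by simp
    show "weight b (raise U m) = weight b m" if "U \<subseteq> I b" "U \<noteq> {}" "C \<le> lev (I b) U m" for b U m
      using C that by simp
  qed simp
qed

end

section \<open>Orbits of maximal classes\<close>

text \<open>The sets f x partition A, and the members of each block contribute a total of 1.\<close>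

lemma card_image_eq_sum_inverse:
  assumes "finite A" and self: "\<And>x. x \<in> A \<Longrightarrow> x \<in> f x" and sub: "\<And>x. x \<in> A \<Longrightarrow> f x \<subseteq> A"
    and eq: "\<And>x y. x \<in> A \<Longrightarrow> y \<in> f x \<Longrightarrow> f y = f x"
  shows "real (card (f ` A)) = (\<Sum>x\<in>A. 1 / real (card (f x)))"
proof -
  have "A = \<Union> (f ` A)"
  proof
    show "A \<subseteq> \<Union> (f ` A)" using self by (intro subsetI UN_I)
    show "\<Union> (f ` A) \<subseteq> A" using sub by (intro UN_least)
  qed
  then have "(\<Sum>x\<in>A. 1 / real (card (f x))) = (\<Sum>x\<in>\<Union> (f ` A). 1 / real (card (f x)))"
    by (rule arg_cong)
  also have "\<dots> = (\<Sum>X\<in>f ` A. \<Sum>x\<in>X. 1 / real (card (f x)))"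
  proof (rule sum.Union_disjoint[unfolded comp_def])
    show "\<forall>X\<in>f ` A. finite X" using finite_subset[OF sub assms(1)] by simp
    show "\<forall>X\<in>f ` A. \<forall>Y\<in>f ` A. X \<noteq> Y \<longrightarrow> X \<inter> Y = {}"
    proof (intro ballI impI)
      fix X Y assume "X \<in> f ` A" "Y \<in> f ` A" "X \<noteq> Y"
      then obtain x y where xy: "x \<in> A" "y \<in> A" "X = f x" "Y = f y" by blast
      have "f x = f y" if "z \<in> f x" "z \<in> f y" for z
        using eq[OF xy(1) that(1)] eq[OF xy(2) that(2)] by simp
      then show "X \<inter> Y = {}" using xy \<open>X \<noteq> Y\<close> by auto
    qed
  qed
  also have "\<dots> = (\<Sum>X\<in>f ` A. 1)"
  proof (rule sum.cong[OF refl])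
    fix X assume "X \<in> f ` A"
    then obtain x where x: "x \<in> A" "X = f x" by blast
    have "finite X" "X \<noteq> {}"
      using finite_subset[OF sub[OF x(1)] assms(1)] self[OF x(1)] x(2) by auto
    have "(\<Sum>y\<in>X. 1 / real (card (f y))) = (\<Sum>y\<in>X. 1 / real (card X))"
      using eq[OF x(1)] x(2) by (intro sum.cong) simp_all
    also have "\<dots> = 1" using \<open>finite X\<close> \<open>X \<noteq> {}\<close> by simp
    finally show "(\<Sum>y\<in>X. 1 / real (card (f y))) = 1" .
  qed
  finally show ?thesis by simp
qed

section \<open>Relabelling along bijections and its complete invariant\<close>

lemma Bij_eq_injections:
  assumes "finite S"
  shows "Bij S = injections S S"
proof
  show "Bij S \<subseteq> injections S S"
    unfolding Bij_def injections_def bij_betw_def PiE_def by auto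
  show "injections S S \<subseteq> Bij S"
  proof
    fix \<pi> assume "\<pi> \<in> injections S S"
    then have \<pi>: "inj_on \<pi> S" "\<pi> ` S \<subseteq> S" "\<pi> \<in> extensional S"
      unfolding injections_def PiE_def by auto
    then have "\<pi> ` S = S" using endo_inj_surj[OF assms] by blast
    then show "\<pi> \<in> Bij S" using \<pi> by (simp add: Bij_def bij_betw_def)
  qed
qed

lemma carrier_BijGroup: "carrier (BijGroup S) = Bij S"
  by (simp add: BijGroup_def)

lemma inv_BijGroup_closed:
  assumes "\<pi> \<in> Bij S"
  shows "inv\<^bsub>BijGroup S\<^esub> \<pi> \<in> Bij S"
  unfolding inv_BijGroup[OF assms] by (rule restrict_inv_into_Bij[OF assms])

lemma injection_onto:
  assumes "finite T" "card S = card T" "\<pi> \<in> injections S T"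
  shows "\<pi> ` S = T"
  using assms unfolding injections_def by (intro card_subset_eq) (auto simp: card_image)

context infinite_compatible_quasi_orders
begin

definition relabel :: "'u set \<Rightarrow> ('u \<Rightarrow> 'u) \<Rightarrow> nat \<times> ('s, 'u) elt \<Rightarrow> nat \<times> ('s, 'u) elt" where
  "relabel S \<pi> = (\<lambda>(b, \<sigma>, \<alpha>). (b, the (model_map (S0 b) S \<pi> (\<sigma>, \<alpha>))))"

text \<open>A complete invariant for relabelling along bijections, also between different sets of
  equal size.\<close>

definition orbit_type :: "'u set \<Rightarrow> nat \<times> ('s, 'u) elt \<Rightarrow> nat \<times> (nat \<Rightarrow> nat)" where
  "orbit_type S = (\<lambda>(b, \<sigma>, \<alpha>). (b, colour_count (S0 b) S \<sigma> \<alpha>))"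

definition cls :: "'u set \<Rightarrow> nat \<times> ('s, 'u) elt \<Rightarrow> (nat \<times> ('s, 'u) elt) set" where
  "cls S x = total_sim qo S `` {x}"

lemma fst_relabel [simp]: "fst (relabel S \<pi> x) = fst x"
  by (simp add: relabel_def split: prod.split)

lemma fst_orbit_type [simp]: "fst (orbit_type S x) = fst x"
  by (simp add: orbit_type_def split: prod.split)

lemma relabel_qo:
  assumes "finite S" "finite T" "\<pi> \<in> injections S T" "\<pi> ` S = T" "(x, y) \<in> qo T"
  shows "(relabel S \<pi> x, relabel S \<pi> y) \<in> qo S"
proof -
  obtain b \<sigma> \<alpha> b' \<tau> \<beta> where xy: "x = (b, \<sigma>, \<alpha>)" "y = (b', \<tau>, \<beta>)"
    by (metis prod_cases3)
  have "\<sigma> ` S0 b \<union> \<tau> ` S0 b' \<subseteq> \<pi> ` S"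
    using objD(3)[OF assms(2)] qo_obj[OF assms(2,5)] assms(4)
    unfolding xy injections_def by blast
  then show ?thesis
    using compat3[OF assms(1-3)] assms(5) unfolding relabel_def xy by simp
qed

lemma relabel_obj:
  assumes "finite S" "finite T" "\<pi> \<in> injections S T" "\<pi> ` S = T" "x \<in> obj T"
  shows "relabel S \<pi> x \<in> obj S"
  using qo_obj(1)[OF assms(1) relabel_qo[OF assms(1-4) qo_refl[OF assms(2,5)]]] .

lemma orbit_type_relabel:
  assumes "finite S" "finite T" "\<pi> \<in> injections S T" "\<pi> ` S = T" "x \<in> obj T"
  shows "orbit_type S (relabel S \<pi> x) = orbit_type T x"
proof -
  obtain b \<sigma> \<alpha> where x: "x = (b, \<sigma>, \<alpha>)" by (metis prod_cases3)
  have inj: "inj_on \<pi> S" using assms(3) by (simp add: injections_def)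
  have im: "\<sigma> ` S0 b \<subseteq> \<pi> ` S"
    using objD(3)[OF assms(2)] assms(4,5) unfolding x injections_def by blast
  define \<sigma>' where "\<sigma>' = compose (S0 b) (inv_into S \<pi>) \<sigma>"
  have rel: "relabel S \<pi> x = (b, \<sigma>', compose (S - \<sigma>' ` S0 b) \<alpha> \<pi>)"
    using im unfolding x relabel_def model_map_def \<sigma>'_def by (simp add: Let_def)
  have \<sigma>'_im: "\<sigma>' ` S0 b = inv_into S \<pi> ` \<sigma> ` S0 b"
    unfolding \<sigma>'_def compose_def image_image by (rule image_cong) simp_all
  have im': "\<pi> ` \<sigma>' ` S0 b = \<sigma> ` S0 b" "\<sigma>' ` S0 b \<subseteq> S"
  proof -
    show "\<pi> ` \<sigma>' ` S0 b = \<sigma> ` S0 b"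
      using im unfolding \<sigma>'_im by (rule image_inv_into_cancel[OF refl])
    show "\<sigma>' ` S0 b \<subseteq> S"
      unfolding \<sigma>'_im
    proof (rule image_subsetI)
      fix u assume "u \<in> \<sigma> ` S0 b"
      then show "inv_into S \<pi> u \<in> S" by (rule inv_into_into[OF subsetD[OF im]])
    qed
  qed
  have "colour_count (S0 b) S \<sigma>' (compose (S - \<sigma>' ` S0 b) \<alpha> \<pi>) j = colour_count (S0 b) T \<sigma> \<alpha> j" for j
  proof -
    have "\<pi> ` (S - \<sigma>' ` S0 b) = T - \<sigma> ` S0 b"
      using inj_on_image_set_diff[OF inj _ im'(2), of S] im'(1) assms(4) by simp
    then have "{u \<in> T - \<sigma> ` S0 b. \<alpha> u = j} = {u \<in> \<pi> ` (S - \<sigma>' ` S0 b). \<alpha> u = j}"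
      by (simp only:)
    also have "\<dots> = \<pi> ` {u \<in> S - \<sigma>' ` S0 b. \<alpha> (\<pi> u) = j}"
      by auto
    finally have "{u \<in> T - \<sigma> ` S0 b. \<alpha> u = j} = \<pi> ` {u \<in> S - \<sigma>' ` S0 b. \<alpha> (\<pi> u) = j}" .
    moreover have "inj_on \<pi> {u \<in> S - \<sigma>' ` S0 b. \<alpha> (\<pi> u) = j}"
      using inj by (rule inj_on_subset) blast
    ultimately have "card {u \<in> T - \<sigma> ` S0 b. \<alpha> u = j} = card {u \<in> S - \<sigma>' ` S0 b. \<alpha> (\<pi> u) = j}"
      by (simp only: card_image)
    also have "{u \<in> S - \<sigma>' ` S0 b. \<alpha> (\<pi> u) = j}
        = {u \<in> S - \<sigma>' ` S0 b. compose (S - \<sigma>' ` S0 b) \<alpha> \<pi> u = j}"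
      by (auto simp: compose_def)
    finally show ?thesis by (simp only: colour_count_def)
  qed
  then show ?thesis unfolding rel by (simp add: x orbit_type_def fun_eq_iff)
qed

text \<open>Label each point by its fibre under the injection and its colour. Equal types give a
  label-preserving injection from S to T, which is onto because both sets have the same
  size.\<close>

lemma orbit_type_eq_imp_relabel:
  assumes fin: "finite S" "finite T" and x: "x \<in> obj S" and y: "y \<in> obj T"
    and eq: "orbit_type S x = orbit_type T y"
  shows "\<exists>\<pi>. \<pi> \<in> injections S T \<and> \<pi> ` S = T \<and> relabel S \<pi> y = x"
proof -
  obtain b \<sigma> \<alpha> where x': "x = (b, \<sigma>, \<alpha>)" by (metis prod_cases3)
  obtain \<tau> \<beta> where y': "y = (b, \<tau>, \<beta>)"
    using eq by (cases y) (auto simp: x' orbit_type_def)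
  have cnt: "colour_count (S0 b) S \<sigma> \<alpha> = colour_count (S0 b) T \<tau> \<beta>"
    using eq by (simp add: x' y' orbit_type_def)
  note X = objD[OF fin(1) x[unfolded x']] and Y = objD[OF fin(2) y[unfolded y']]
  have card: "card S = card T"
    using obj_card[OF fin(1) x[unfolded x']] obj_card[OF fin(2) y[unfolded y']] cnt by simp
  define lab where "lab \<sigma> \<alpha> u = ({e\<in>S0 b. \<sigma> e = u}, \<alpha> u)" for \<sigma> :: "'s \<Rightarrow> 'u" and \<alpha> :: "'u \<Rightarrow> nat" and u
  have "card {u\<in>S. lab \<sigma> \<alpha> u = l} \<le> card {u\<in>T. lab \<tau> \<beta> u = l}" for l
  proof (cases "\<exists>u\<in>S. lab \<sigma> \<alpha> u = l")
    case False
    then have "{u\<in>S. lab \<sigma> \<alpha> u = l} = {}" by blast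
    then show ?thesis by (simp only: card.empty)
  next
    case True
    then obtain u where u: "u \<in> S" "lab \<sigma> \<alpha> u = l" by blast
    show ?thesis
    proof (cases "u \<in> \<sigma> ` S0 b")
      case True
      then obtain e where e: "e \<in> S0 b" "u = \<sigma> e" by blast
      \<comment> \<open>The label of an image point determines that point: its fibre is a singleton,
        and its colour is \<open>undefined\<close> on both sides.\<close>
      have l: "l = ({e}, undefined)"
      proof -
        have "{e'\<in>S0 b. \<sigma> e' = u} = {e}"
          using e X(3) by (auto simp: injections_def inj_on_def)
        moreover have "\<alpha> u = undefined" using X(5) True by (auto simp: extensional_def)
        ultimately show ?thesis using u by (simp add: lab_def)
      qed
      have "{u\<in>S. lab \<sigma> \<alpha> u = l} \<subseteq> {\<sigma> e}"
      proof
        fix u' assume "u' \<in> {u\<in>S. lab \<sigma> \<alpha> u = l}"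
        then have "{e'\<in>S0 b. \<sigma> e' = u'} = {e}" by (simp add: lab_def l)
        then have "e \<in> {e'\<in>S0 b. \<sigma> e' = u'}" by (simp only: singletonI)
        then show "u' \<in> {\<sigma> e}" by simp
      qed
      then have "card {u\<in>S. lab \<sigma> \<alpha> u = l} \<le> 1"
        using card_mono[of "{\<sigma> e}"] by simp
      moreover have "\<tau> e \<in> {u\<in>T. lab \<tau> \<beta> u = l}"
      proof -
        have "{e'\<in>S0 b. \<tau> e' = \<tau> e} = {e}"
          using e Y(3) by (auto simp: injections_def inj_on_def)
        moreover have "\<beta> (\<tau> e) = undefined" using Y(5) e by (auto simp: extensional_def)
        moreover have "\<tau> e \<in> T" using e Y(3) by (auto simp: injections_def)
        ultimately show ?thesis by (simp add: lab_def l)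
      qed
      then have "card {u\<in>T. lab \<tau> \<beta> u = l} \<ge> 1"
        using card_mono[of "{u\<in>T. lab \<tau> \<beta> u = l}" "{\<tau> e}"] fin(2) by simp
      ultimately show ?thesis by simp
    next
      case False
      then have l: "l = ({}, \<alpha> u)" using u by (auto simp: lab_def)
      have "{u'\<in>S. lab \<sigma> \<alpha> u' = l} = {u' \<in> S - \<sigma> ` S0 b. \<alpha> u' = \<alpha> u}"
        unfolding l lab_def by blast
      moreover have "{u'\<in>T. lab \<tau> \<beta> u' = l} = {u' \<in> T - \<tau> ` S0 b. \<beta> u' = \<alpha> u}"
        unfolding l lab_def by blast
      ultimately show ?thesis
        using fun_cong[OF cnt, of "\<alpha> u"] by (simp only: colour_count_def)
    qed
  qed
  then have "\<exists>\<pi>. inj_on \<pi> S \<and> \<pi> ` S \<subseteq> T \<and> (\<forall>u\<in>S. lab \<tau> \<beta> (\<pi> u) = lab \<sigma> \<alpha> u)"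
    using fin by (intro fibrewise_injection)
  then obtain \<pi>0 where \<pi>0: "inj_on \<pi>0 S \<and> \<pi>0 ` S \<subseteq> T \<and> (\<forall>u\<in>S. lab \<tau> \<beta> (\<pi>0 u) = lab \<sigma> \<alpha> u)" ..
  define \<pi> where "\<pi> = restrict \<pi>0 S"
  have \<pi>: "inj_on \<pi> S" "\<pi> ` S \<subseteq> T" and lab: "\<And>u. u \<in> S \<Longrightarrow> lab \<tau> \<beta> (\<pi> u) = lab \<sigma> \<alpha> u"
    using \<pi>0 by (auto simp: \<pi>_def inj_on_def)
  have inj: "\<pi> \<in> injections S T"
    using \<pi> by (auto simp: \<pi>_def injections_def)
  have "model_map (S0 b) S \<pi> (\<tau>, \<beta>) = Some (\<sigma>, \<alpha>)"
  proof (rule model_map_eq[OF X(3,5) \<pi>(1)])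
    show "\<tau> e = \<pi> (\<sigma> e)" if e: "e \<in> S0 b" for e
    proof -
      have "\<sigma> e \<in> S" using e X(3) by (auto simp: injections_def)
      then have "{e'\<in>S0 b. \<tau> e' = \<pi> (\<sigma> e)} = {e'\<in>S0 b. \<sigma> e' = \<sigma> e}"
        using lab[of "\<sigma> e"] by (simp add: lab_def)
      then show ?thesis using e by blast
    qed
    show "\<beta> (\<pi> u) = \<alpha> u" if "u \<in> S - \<sigma> ` S0 b" for u
      using lab[of u] that by (simp add: lab_def)
  qed
  then have "relabel S \<pi> y = x" by (simp add: relabel_def x' y')
  then show ?thesis using inj injection_onto[OF fin(2) card inj] by blast
qed

section \<open>Equivalence classes, maximality and the action\<close>

lemma qo_fst_eq:
  assumes "finite S" "(x, y) \<in> qo S" "fst x = fst y"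
  shows "(y, x) \<in> qo S"
proof -
  obtain b x' y' where xy: "x = (b, x')" "y = (b, y')" using assms(3) by (metis prod.collapse)
  have b: "b \<in> {1..a}"
    using qo_obj(1)[OF assms(1,2)] by (auto simp: xy total_obj_def)
  interpret mf: model_functor "S0 b" "k b" "E b" "sim b" using model[OF b] .
  have "(x', y') \<in> sim b S" using compat2[OF assms(1) b] assms(2) by (auto simp: xy)
  then have "(y', x') \<in> sim b S" using mf.equiv_sim[OF assms(1)] by (meson equivE symD)
  then show ?thesis using compat2[OF assms(1) b] by (auto simp: xy)
qed

lemma qo_fst_le:
  assumes "finite S" "(x, y) \<in> qo S"
  shows "fst x \<le> fst y"
  using compat1[OF assms(1), of "fst x" "snd x" "fst y" "snd y"] assms(2) by simp

text \<open>Mutual comparability forces equal indices by compatibility (1); conversely, for equal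
  indices one comparison suffices by compatibility (2).\<close>

lemma mem_cls_iff:
  assumes "finite S"
  shows "y \<in> cls S x \<longleftrightarrow> (x, y) \<in> qo S \<and> fst x = fst y"
proof -
  have "y \<in> cls S x \<longleftrightarrow> (x, y) \<in> qo S \<and> (y, x) \<in> qo S"
    by (simp add: cls_def total_sim_def)
  then show ?thesis
    using qo_fst_eq[OF assms, of x y] qo_fst_le[OF assms, of x y] qo_fst_le[OF assms, of y x] by auto
qed

lemma cls_self: "finite S \<Longrightarrow> x \<in> obj S \<Longrightarrow> x \<in> cls S x"
  by (simp add: mem_cls_iff qo_refl)

lemma cls_eq:
  assumes "finite S" "y \<in> cls S x"
  shows "cls S y = cls S x"
proof -
  have xy: "(x, y) \<in> qo S" "fst x = fst y" using assms by (simp_all add: mem_cls_iff)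
  have yx: "(y, x) \<in> qo S" using qo_fst_eq[OF assms(1) xy] .
  show ?thesis
  proof (rule Set.set_eqI)
    fix z
    show "z \<in> cls S y \<longleftrightarrow> z \<in> cls S x"
      using qo_trans[OF assms(1) xy(1), of z] qo_trans[OF assms(1) yx, of z] xy(2)
      by (auto simp: mem_cls_iff[OF assms(1)])
  qed
qed

lemma total_classes_eq: "total_classes a S0 E qo S = cls S ` obj S"
  by (auto simp: total_classes_def quotient_def cls_def)

text \<open>The witness of \<open>rel\<close> may live on another set T; it is transported to S
  along a bijection that carries its first component to x.\<close>

lemma extendsE:
  assumes "finite S" "x \<in> obj S" "rel (fst x) b' (snd (orbit_type S x)) m'"
  obtains y where "(x, y) \<in> qo S" "orbit_type S y = (b', m')"
proof -
  obtain T \<sigma> \<alpha> \<tau> \<beta> where T: "finite T" and qo: "((fst x, \<sigma>, \<alpha>), (b', \<tau>, \<beta>)) \<in> qo T"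
    and m: "snd (orbit_type S x) = colour_count (S0 (fst x)) T \<sigma> \<alpha>" "m' = colour_count (S0 b') T \<tau> \<beta>"
    using assms(3) unfolding rel_def joint_def by blast
  have "orbit_type S x = orbit_type T (fst x, \<sigma>, \<alpha>)"
    using m(1) by (simp add: prod_eq_iff) (simp add: orbit_type_def)
  then obtain \<pi> where \<pi>: "\<pi> \<in> injections S T" "\<pi> ` S = T" "relabel S \<pi> (fst x, \<sigma>, \<alpha>) = x"
    using orbit_type_eq_imp_relabel[OF assms(1) T assms(2) qo_obj(1)[OF T qo]] by blast
  show thesis
  proof (rule that)
    show "(x, relabel S \<pi> (b', \<tau>, \<beta>)) \<in> qo S"
      using relabel_qo[OF assms(1) T \<pi>(1,2) qo] \<pi>(3) by simp
    show "orbit_type S (relabel S \<pi> (b', \<tau>, \<beta>)) = (b', m')"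
      using orbit_type_relabel[OF assms(1) T \<pi>(1,2) qo_obj(2)[OF T qo]] m(2)
      by (simp add: orbit_type_def)
  qed
qed

lemma qo_imp_rel:
  assumes "finite S" "(x, y) \<in> qo S"
  shows "rel (fst x) (fst y) (snd (orbit_type S x)) (snd (orbit_type S y))"
proof -
  obtain b \<sigma> \<alpha> b' \<tau> \<beta> where xy: "x = (b, \<sigma>, \<alpha>)" "y = (b', \<tau>, \<beta>)"
    by (metis prod_cases3)
  have "joint b b' (colour_count (S0 b) S \<sigma> \<alpha>) (colour_count (S0 b') S \<tau> \<beta>)
      (joint_count (S0 b) (S0 b') S \<sigma> \<alpha> \<tau> \<beta>)"
    unfolding joint_def using assms unfolding xy by blast
  then show ?thesis unfolding rel_def xy orbit_type_def by auto
qed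

text \<open>A class strictly above another has a strictly larger index. Hence maximality depends
  only on the orbit type.\<close>

lemma cls_maximal_iff:
  assumes "finite S" "x \<in> obj S"
  shows "cls S x \<in> comp_obj a S0 E qo S \<longleftrightarrow>
    \<not> (\<exists>b'>fst x. extends (fst x) b' (snd (orbit_type S x)))"
proof
  assume max: "cls S x \<in> comp_obj a S0 E qo S"
  show "\<not> (\<exists>b'>fst x. extends (fst x) b' (snd (orbit_type S x)))"
  proof
    assume "\<exists>b'>fst x. extends (fst x) b' (snd (orbit_type S x))"
    then obtain b' m' where b': "fst x < b'" "rel (fst x) b' (snd (orbit_type S x)) m'"
      unfolding extends_def by blast
    obtain y where y: "(x, y) \<in> qo S" "orbit_type S y = (b', m')"
      using extendsE[OF assms b'(2)] .
    have "y \<in> obj S" using qo_obj(2)[OF assms(1) y(1)] .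
    moreover have "class_le qo S (cls S x) (cls S y)"
      unfolding class_le_def using y(1) cls_self assms \<open>y \<in> obj S\<close> by blast
    ultimately have "cls S y = cls S x"
      using max unfolding comp_obj_def total_classes_eq by blast
    then have "y \<in> cls S x" using cls_self[OF assms(1) \<open>y \<in> obj S\<close>] by simp
    then have "fst x = fst y" using assms(1) by (simp add: mem_cls_iff)
    moreover have "fst y = b'" using y(2) fst_orbit_type[of S y] by simp
    ultimately show False using b'(1) by simp
  qed
next
  assume nex: "\<not> (\<exists>b'>fst x. extends (fst x) b' (snd (orbit_type S x)))"
  have "cls S y = cls S x" if y: "y \<in> obj S" and le: "class_le qo S (cls S x) (cls S y)" for y
  proof -
    obtain x' y' where x': "x' \<in> cls S x" "y' \<in> cls S y" "(x', y') \<in> qo S"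
      using le unfolding class_le_def by blast
    then have xy: "(x, y') \<in> qo S"
      using qo_trans[OF assms(1)] assms(1) by (meson mem_cls_iff)
    then have "extends (fst x) (fst y') (snd (orbit_type S x))"
      unfolding extends_def using qo_imp_rel[OF assms(1)] by blast
    then have "fst x = fst y'" using nex qo_fst_le[OF assms(1) xy] by (meson le_neq_implies_less)
    then have "y' \<in> cls S x" using xy assms(1) by (simp add: mem_cls_iff)
    then show ?thesis using cls_eq[OF assms(1) x'(2)] cls_eq[OF assms(1), of y' x] by simp
  qed
  then show "cls S x \<in> comp_obj a S0 E qo S"
    unfolding comp_obj_def total_classes_eq using assms(2) by blast
qed

text \<open>The description operator in \<open>comp_map\<close> is well defined here: relabelling
  respects the quasi-order, so all representatives give one class, and it preserves types, so that
  class is maximal.\<close>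

lemma sym_action_cls:
  assumes S: "finite S" and x: "x \<in> obj S" and max: "cls S x \<in> comp_obj a S0 E qo S"
    and \<pi>: "\<pi> \<in> Bij S"
  shows "sym_action a S0 E qo S \<pi> (cls S x) = cls S (relabel S (inv\<^bsub>BijGroup S\<^esub> \<pi>) x)"
proof -
  let ?\<rho> = "inv\<^bsub>BijGroup S\<^esub> \<pi>"
  have "?\<rho> \<in> Bij S"
    using \<pi> by (rule inv_BijGroup_closed)
  then have \<rho>: "?\<rho> \<in> injections S S" "?\<rho> ` S = S"
    using Bij_eq_injections[OF S] by (auto simp: Bij_def bij_betw_def)
  have max': "cls S (relabel S ?\<rho> x) \<in> comp_obj a S0 E qo S"
    using max cls_maximal_iff[OF S x] cls_maximal_iff[OF S relabel_obj[OF S S \<rho> x]]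
      orbit_type_relabel[OF S S \<rho> x] by simp
  have "comp_image a S0 E qo S ?\<rho> (cls S x) c' \<longleftrightarrow> c' = cls S (relabel S ?\<rho> x)" for c'
  proof
    assume "comp_image a S0 E qo S ?\<rho> (cls S x) c'"
    then obtain b \<sigma> \<alpha> where "(b, \<sigma>, \<alpha>) \<in> cls S x"
      "c' = total_sim qo S `` {(b, the (model_map (S0 b) S ?\<rho> (\<sigma>, \<alpha>)))}"
      unfolding comp_image_def by blast
    then have y: "(b, \<sigma>, \<alpha>) \<in> cls S x" "c' = cls S (relabel S ?\<rho> (b, \<sigma>, \<alpha>))"
      by (simp_all add: cls_def relabel_def)
    then have "relabel S ?\<rho> (b, \<sigma>, \<alpha>) \<in> cls S (relabel S ?\<rho> x)"
      using relabel_qo[OF S S \<rho>, of x "(b, \<sigma>, \<alpha>)"] by (simp add: mem_cls_iff[OF S])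
    then show "c' = cls S (relabel S ?\<rho> x)" using cls_eq[OF S] y(2) by simp
  next
    assume c': "c' = cls S (relabel S ?\<rho> x)"
    obtain b \<sigma> \<alpha> where x': "x = (b, \<sigma>, \<alpha>)" by (metis prod_cases3)
    have "(b, \<sigma>, \<alpha>) \<in> cls S x" using cls_self[OF S x] unfolding x' .
    moreover have "\<sigma> ` S0 b \<subseteq> ?\<rho> ` S"
      using objD(3)[OF S x[unfolded x']] \<rho>(2) by (auto simp: injections_def)
    moreover have "c' = total_sim qo S `` {(b, the (model_map (S0 b) S ?\<rho> (\<sigma>, \<alpha>)))}"
      unfolding c' x' cls_def relabel_def by simp
    moreover have "c' \<in> comp_obj a S0 E qo S" unfolding c' using max' .
    ultimately show "comp_image a S0 E qo S ?\<rho> (cls S x) c'"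
      unfolding comp_image_def by blast
  qed
  then have "comp_image a S0 E qo S ?\<rho> (cls S x) = (\<lambda>c'. c' = cls S (relabel S ?\<rho> x))"
    by (rule ext)
  then have "comp_map a S0 E qo S ?\<rho> (cls S x) = Some (cls S (relabel S ?\<rho> x))"
    unfolding comp_map_def by simp
  then show ?thesis unfolding sym_action_def using max by simp
qed

lemma orbit_cls:
  assumes S: "finite S" and x: "x \<in> obj S" and max: "cls S x \<in> comp_obj a S0 E qo S"
  shows "orbit (BijGroup S) (sym_action a S0 E qo S) (cls S x)
    = cls S ` {y \<in> obj S. orbit_type S y = orbit_type S x}"
proof (rule Set.set_eqI, rule iffI)
  fix c assume "c \<in> orbit (BijGroup S) (sym_action a S0 E qo S) (cls S x)"
  then obtain \<pi> where \<pi>: "\<pi> \<in> Bij S" "c = sym_action a S0 E qo S \<pi> (cls S x)"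
    unfolding orbit_def carrier_BijGroup by blast
  have "inv\<^bsub>BijGroup S\<^esub> \<pi> \<in> Bij S"
    using \<pi>(1) by (rule inv_BijGroup_closed)
  then have \<rho>: "inv\<^bsub>BijGroup S\<^esub> \<pi> \<in> injections S S" "(inv\<^bsub>BijGroup S\<^esub> \<pi>) ` S = S"
    using Bij_eq_injections[OF S] by (auto simp: Bij_def bij_betw_def)
  show "c \<in> cls S ` {y \<in> obj S. orbit_type S y = orbit_type S x}"
    using sym_action_cls[OF S x max \<pi>(1)] \<pi>(2) relabel_obj[OF S S \<rho> x]
      orbit_type_relabel[OF S S \<rho> x] by blast
next
  fix c assume "c \<in> cls S ` {y \<in> obj S. orbit_type S y = orbit_type S x}"
  then obtain y where y: "y \<in> obj S" "orbit_type S y = orbit_type S x" "c = cls S y" by blast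
  obtain \<rho> where \<rho>: "\<rho> \<in> injections S S" "relabel S \<rho> x = y"
    using orbit_type_eq_imp_relabel[OF S S y(1) x y(2)] by blast
  have car: "\<rho> \<in> carrier (BijGroup S)"
    using \<rho>(1) unfolding carrier_BijGroup Bij_eq_injections[OF S] .
  \<comment> \<open>The action goes through the inverse, so the group element sending the class of x
    to that of y is the inverse of \<rho>.\<close>
  define \<pi> where "\<pi> = inv\<^bsub>BijGroup S\<^esub> \<rho>"
  have \<pi>: "\<pi> \<in> carrier (BijGroup S)" "inv\<^bsub>BijGroup S\<^esub> \<pi> = \<rho>"
    unfolding \<pi>_def using group.inv_closed[OF group_BijGroup car] group.inv_inv[OF group_BijGroup car]
    by simp_all
  then have "\<pi> \<in> Bij S" unfolding carrier_BijGroup by blast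
  then have "c = sym_action a S0 E qo S \<pi> (cls S x)"
    using sym_action_cls[OF S x max] \<pi>(2) \<rho>(2) y(3) by simp
  then show "c \<in> orbit (BijGroup S) (sym_action a S0 E qo S) (cls S x)"
    unfolding orbit_def using \<pi>(1) by blast
qed

section \<open>Counting orbits through their types\<close>

definition maximal_types :: "nat \<Rightarrow> (nat \<times> (nat \<Rightarrow> nat)) set" where
  "maximal_types n = (SIGMA b:{1..a}. {m \<in> comps (I b) (card (S0 b)) n.
     extends b b m \<and> \<not> (\<exists>b'>b. extends b b' m)})"

definition related_types :: "nat \<times> (nat \<Rightarrow> nat) \<Rightarrow> (nat \<times> (nat \<Rightarrow> nat)) set" where
  "related_types t = Pair (fst t) ` {m'. rel (fst t) (fst t) (snd t) m'}"

lemma maximal_types_eq: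
  assumes S: "finite S"
  shows "maximal_types (card S) = orbit_type S ` {x \<in> obj S. cls S x \<in> comp_obj a S0 E qo S}"
proof (rule Set.set_eqI, rule iffI)
  fix t assume "t \<in> maximal_types (card S)"
  then obtain b m where t: "t = (b, m)" and m: "m \<in> comps (I b) (card (S0 b)) (card S)"
    "extends b b m" and max: "\<not> (\<exists>b'>b. extends b b' m)"
    unfolding maximal_types_def by blast
  obtain T \<sigma> \<alpha> y where T: "finite T" and qo: "((b, \<sigma>, \<alpha>), y) \<in> qo T"
    and mT: "m = colour_count (S0 b) T \<sigma> \<alpha>"
    using m(2) unfolding extends_def rel_def joint_def by blast
  have x': "(b, \<sigma>, \<alpha>) \<in> obj T" using qo_obj(1)[OF T qo] .
  \<comment> \<open>The witness for m lives on an unrelated set T; membership in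
    \<open>comps\<close> fixes its size, which permits transport to S.\<close>
  have card: "card S = card T"
    using m(1) obj_card[OF T x'] by (simp add: comps_def mT)
  then obtain \<pi>0 where "bij_betw \<pi>0 S T" using finite_same_card_bij[OF S T] by blast
  then have "restrict \<pi>0 S \<in> injections S T"
    by (auto simp: injections_def bij_betw_def inj_on_def)
  then obtain \<pi> where \<pi>: "\<pi> \<in> injections S T" by blast
  note \<pi>' = injection_onto[OF T card \<pi>]
  define x where "x = relabel S \<pi> (b, \<sigma>, \<alpha>)"
  have x: "x \<in> obj S" unfolding x_def using relabel_obj[OF S T \<pi> \<pi>' x'] .
  have tx: "orbit_type S x = (b, m)"
    unfolding x_def orbit_type_relabel[OF S T \<pi> \<pi>' x'] by (simp add: orbit_type_def mT)
  then have "fst x = b" using fst_orbit_type[of S x] by simp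
  then have "cls S x \<in> comp_obj a S0 E qo S"
    using cls_maximal_iff[OF S x] max tx by simp
  then show "t \<in> orbit_type S ` {x \<in> obj S. cls S x \<in> comp_obj a S0 E qo S}"
    using x tx t by force
next
  fix t assume "t \<in> orbit_type S ` {x \<in> obj S. cls S x \<in> comp_obj a S0 E qo S}"
  then obtain x where x: "x \<in> obj S" "cls S x \<in> comp_obj a S0 E qo S" and t: "t = orbit_type S x"
    by blast
  obtain b \<sigma> \<alpha> where x': "x = (b, \<sigma>, \<alpha>)" by (metis prod_cases3)
  let ?m = "colour_count (S0 b) S \<sigma> \<alpha>"
  have "b \<in> {1..a}" using objD(1)[OF S x(1)[unfolded x']] .
  moreover have "?m \<in> comps (I b) (card (S0 b)) (card S)"
    using obj_card[OF S x(1)[unfolded x']] colour_count_eq_0[OF S x(1)[unfolded x']]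
    by (simp add: comps_def)
  moreover have "extends b b ?m"
    using qo_imp_rel[OF S qo_refl[OF S x(1)]] unfolding x' extends_def orbit_type_def by auto
  moreover have "\<not> (\<exists>b'>b. extends b b' ?m)"
    using cls_maximal_iff[OF S x(1)] x(2) unfolding x' orbit_type_def by simp
  ultimately show "t \<in> maximal_types (card S)"
    unfolding maximal_types_def t x' orbit_type_def by simp
qed

text \<open>Running through the orbit replaces x by any y of the same type, and running through the
  classes replaces y by any equivalent z; on types only the second step is visible.\<close>

lemma types_of_orbit:
  assumes S: "finite S" and x: "x \<in> obj S"
  shows "orbit_type S ` \<Union> (cls S ` {y \<in> obj S. orbit_type S y = orbit_type S x})
    = related_types (orbit_type S x)"
proof (rule Set.set_eqI, rule iffI)
  fix t assume "t \<in> orbit_type S ` \<Union> (cls S ` {y \<in> obj S. orbit_type S y = orbit_type S x})"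
  then obtain y z where y: "orbit_type S y = orbit_type S x" and z: "z \<in> cls S y" "t = orbit_type S z"
    by blast
  then have "(y, z) \<in> qo S" "fst y = fst z" using mem_cls_iff[OF S] by blast+
  moreover have "fst y = fst x" using y fst_orbit_type by metis
  ultimately have "rel (fst x) (fst x) (snd (orbit_type S x)) (snd t)" "fst t = fst x"
    using qo_imp_rel[OF S, of y z] y z(2) by simp_all
  then show "t \<in> related_types (orbit_type S x)"
    unfolding related_types_def by (cases t) simp
next
  fix t assume "t \<in> related_types (orbit_type S x)"
  then obtain m' where t: "t = (fst x, m')" and r: "rel (fst x) (fst x) (snd (orbit_type S x)) m'"
    unfolding related_types_def by auto
  obtain y where y: "(x, y) \<in> qo S" "orbit_type S y = (fst x, m')"
    using extendsE[OF S x r] .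
  have "fst x = fst y" using y(2) fst_orbit_type[of S y] by simp
  then have "y \<in> cls S x" using y(1) by (simp add: mem_cls_iff[OF S])
  then show "t \<in> orbit_type S ` \<Union> (cls S ` {y \<in> obj S. orbit_type S y = orbit_type S x})"
    using x y(2) t by force
qed

text \<open>An orbit of maximal classes is recovered from the set of types occurring in its classes.
  Orbits thus become blocks of a partition of \<open>maximal_types\<close>, counted by inverse block
  sizes.\<close>

lemma card_orbits:
  assumes S: "finite S"
  shows "real (card (orbits (BijGroup S) (comp_obj a S0 E qo S) (sym_action a S0 E qo S)))
    = (\<Sum>b\<in>{1..a}. \<Sum>m\<in>comps (I b) (card (S0 b)) (card S). weight b m)"
proof -
  let ?M = "{x \<in> obj S. cls S x \<in> comp_obj a S0 E qo S}"
  define orb where "orb x = cls S ` {y \<in> obj S. orbit_type S y = orbit_type S x}" for x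
  have "comp_obj a S0 E qo S \<subseteq> cls S ` obj S"
    unfolding comp_obj_def total_classes_eq by (rule Collect_subset)
  then have "comp_obj a S0 E qo S = cls S ` obj S \<inter> {c. c \<in> comp_obj a S0 E qo S}" by auto
  also have "\<dots> = cls S ` ?M" by auto
  finally have comp: "comp_obj a S0 E qo S = cls S ` ?M" .
  have "orbits (BijGroup S) (comp_obj a S0 E qo S) (sym_action a S0 E qo S)
      = orbit (BijGroup S) (sym_action a S0 E qo S) ` comp_obj a S0 E qo S"
    unfolding orbits_def by (rule Setcompr_eq_image)
  also have "\<dots> = orbit (BijGroup S) (sym_action a S0 E qo S) ` cls S ` ?M"
    by (rule arg_cong[OF comp])
  also have "\<dots> = (\<lambda>x. orbit (BijGroup S) (sym_action a S0 E qo S) (cls S x)) ` ?M"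
    by (rule image_image)
  also have "\<dots> = orb ` ?M"
    unfolding orb_def using orbit_cls[OF S] by (intro image_cong) simp_all
  finally have orbits: "orbits (BijGroup S) (comp_obj a S0 E qo S) (sym_action a S0 E qo S) = orb ` ?M" .
  have orb_types: "orbit_type S ` \<Union> (orb x) = related_types (orbit_type S x)" if "x \<in> ?M" for x
    unfolding orb_def using types_of_orbit[OF S] that by simp
  have orb_cls: "orb y = orb x" if "x \<in> ?M" "y \<in> cls S x" for x y
  proof -
    have "y \<in> obj S" using that mem_cls_iff[OF S] qo_obj(2)[OF S] by blast
    then have "orb y = orbit (BijGroup S) (sym_action a S0 E qo S) (cls S y)"
      unfolding orb_def using orbit_cls[OF S, of y] that cls_eq[OF S that(2)] by simp
    then show ?thesis unfolding orb_def using orbit_cls[OF S, of x] that cls_eq[OF S that(2)] by simp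
  qed
  have mem_class: "\<exists>z. orb z = orb x \<and> z \<in> ?M \<and> orbit_type S z = t"
    if x: "x \<in> ?M" and t: "t \<in> related_types (orbit_type S x)" for x t
  proof -
    obtain y z where y: "y \<in> obj S" "orbit_type S y = orbit_type S x" and z: "z \<in> cls S y" "t = orbit_type S z"
      using t unfolding orb_types[OF x, symmetric] orb_def by blast
    have y': "y \<in> ?M"
    proof -
      have "fst y = fst x" using y(2) fst_orbit_type by metis
      then show ?thesis using x y cls_maximal_iff[OF S, of x] cls_maximal_iff[OF S, of y] by simp
    qed
    have "orb z = orb y" using orb_cls[OF y' z(1)] .
    also have "orb y = orb x" unfolding orb_def y(2) ..
    finally have "orb z = orb x" .
    moreover have "z \<in> ?M"
      using y' z(1) cls_eq[OF S z(1)] qo_obj(2)[OF S, of y z] mem_cls_iff[OF S] by simp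
    ultimately show ?thesis using z(2) by blast
  qed
  \<comment> \<open>If the type sets agree, the type of \<open>x2\<close> is realised by some z with
    the orbit of \<open>x1\<close>; since \<open>orb\<close> depends only on the type, the orbits
    coincide.\<close>
  have "inj_on (\<lambda>o'. orbit_type S ` \<Union> o') (orb ` ?M)"
  proof (rule inj_onI)
    fix o1 o2 assume "o1 \<in> orb ` ?M" "o2 \<in> orb ` ?M" and eq: "orbit_type S ` \<Union> o1 = orbit_type S ` \<Union> o2"
    then obtain x1 x2 where x: "x1 \<in> ?M" "o1 = orb x1" "x2 \<in> ?M" "o2 = orb x2" by blast
    have "x2 \<in> \<Union> (orb x2)"
      unfolding orb_def using x(3) cls_self[OF S, of x2] by blast
    then have "orbit_type S x2 \<in> related_types (orbit_type S x1)"
      using eq orb_types[OF x(1)] x by blast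
    then obtain z where z: "orb z = orb x1" "orbit_type S z = orbit_type S x2"
      using mem_class[OF x(1)] by blast
    have "orb z = orb x2" unfolding orb_def z(2) ..
    then show "o1 = o2" using z(1) x by simp
  qed
  then have "card (orb ` ?M) = card ((\<lambda>o'. orbit_type S ` \<Union> o') ` orb ` ?M)"
    by (rule card_image[symmetric])
  also have "(\<lambda>o'. orbit_type S ` \<Union> o') ` orb ` ?M = related_types ` orbit_type S ` ?M"
    unfolding image_image using orb_types by (rule image_cong[OF refl])
  also have "orbit_type S ` ?M = maximal_types (card S)"
    by (rule maximal_types_eq[OF S, symmetric])
  finally have "card (orb ` ?M) = card (related_types ` maximal_types (card S))" .
  moreover have "real (card (related_types ` maximal_types (card S)))
      = (\<Sum>t\<in>maximal_types (card S). 1 / real (card (related_types t)))"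
  proof (rule card_image_eq_sum_inverse)
    show "finite (maximal_types (card S))"
      unfolding maximal_types_def using finite_comps by (intro finite_SigmaI) auto
    fix t assume "t \<in> maximal_types (card S)"
    then obtain x where x: "x \<in> ?M" and t: "t = orbit_type S x"
      unfolding maximal_types_eq[OF S] by blast
    have "x \<in> \<Union> (orb x)" unfolding orb_def using x cls_self[OF S, of x] by blast
    then show "t \<in> related_types t" unfolding t orb_types[OF x, symmetric] by blast
    show "related_types t \<subseteq> maximal_types (card S)"
      unfolding t maximal_types_eq[OF S] using mem_class[OF x] by blast
    fix t' assume "t' \<in> related_types t"
    then obtain z where "orb z = orb x" "z \<in> ?M" "orbit_type S z = t'"
      using mem_class[OF x] t by blast
    then show "related_types t' = related_types t"
      using orb_types[of z] orb_types[OF x] t by simp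
  qed
  moreover have "(\<Sum>t\<in>maximal_types (card S). 1 / real (card (related_types t)))
      = (\<Sum>b\<in>{1..a}. \<Sum>m\<in>comps (I b) (card (S0 b)) (card S). weight b m)"
  proof -
    have "(\<Sum>t\<in>maximal_types (card S). 1 / real (card (related_types t)))
        = (\<Sum>(b, m)\<in>maximal_types (card S). 1 / real (card {m'. rel b b m m'}))"
      unfolding related_types_def by (intro sum.cong) (auto simp: card_image inj_on_def)
    also have "\<dots> = (\<Sum>b\<in>{1..a}. \<Sum>m\<in>{m \<in> comps (I b) (card (S0 b)) (card S).
        extends b b m \<and> \<not> (\<exists>b'>b. extends b b' m)}. 1 / real (card {m'. rel b b m m'}))"
      unfolding maximal_types_def using finite_comps by (intro sum.Sigma[symmetric]) auto
    also have "\<dots> = (\<Sum>b\<in>{1..a}. \<Sum>m\<in>comps (I b) (card (S0 b)) (card S). weight b m)"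
      unfolding weight_def using finite_comps by (intro sum.cong refl sum.inter_filter) auto
    finally show ?thesis .
  qed
  ultimately show ?thesis unfolding orbits by simp
qed

end

theorem theorem5p32:
  fixes a :: nat and S0 :: "nat \<Rightarrow> 's set" and k :: "nat \<Rightarrow> nat"
    and E :: "nat \<Rightarrow> 'u set \<Rightarrow> ('u \<Rightarrow> nat) set"
    and sim :: "nat \<Rightarrow> 'u set \<Rightarrow> ('s, 'u) elt rel"
    and qo :: "'u set \<Rightarrow> (nat \<times> ('s, 'u) elt) rel"
  assumes "infinite (UNIV :: 'u set)"
    and "compatible_quasi_orders a S0 k E sim qo"
  shows "\<exists>q. quasipolynomial q \<and>
    (\<exists>N::nat. \<forall>S::'u set. finite S \<and> N \<le> card S \<longrightarrow>
       real (card (orbits (BijGroup S) (comp_obj a S0 E qo S) (sym_action a S0 E qo S)))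
         = q (int (card S)))"
proof -
  interpret infinite_compatible_quasi_orders a S0 k E sim qo
    using assms by (simp add: infinite_compatible_quasi_orders_def infinite_compatible_quasi_orders_axioms_def)
  obtain q N where "quasipolynomial q" and
    "\<And>n. n \<ge> N \<Longrightarrow> (\<Sum>b\<in>{1..a}. \<Sum>m\<in>comps (I b) (card (S0 b)) n. weight b m) = q (int n)"
    using ev_quasipoly_imp_quasipolynomial[OF weight_sum_ev_quasipoly] by blast
  then show ?thesis using card_orbits by (intro exI[of _ q] conjI exI[of _ N]) auto
qed

end
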